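(* Let $n\in\mathbb{N}_+$ and let $\lambda,\mu^0,\mu^1,\dots,\mu^{n-1}$ be partitions. If the Littlewood–Richardson coefficient $c^\lambda_{\mu^0,\mu^1,\dots,\mu^{n-1}}$ is nonzero, then \[[\lambda]\subseteq\Big\langle \sum_{k=0}^{n-1}\mathrm{OC}(\mu^k)\Big\rangle^c,\] where $\sum_k \mathrm{OC}(\mu^k)=\{p_0+p_1+\dots+p_{n-1}: p_k\in\mathrm{OC}(\mu^k)\}$ is the Minkowski sum with coordinatewise addition in $\mathbb{N}_0^2$. Equivalently, no point of $\sum_k\mathrm{OC}(\mu^k)$ lies in $[\lambda]$.
   Context: For a partition $\lambda=(\lambda_1\ge\lambda_2\ge\cdots)$, its diagram is $[\lambda]=\{(j,i)\in\mathbb{N}_0^2: 0\le j<\lambda_{i+1}\}$, where the first coordinate is the column index and the second the row index, both starting at $0$. The set of outer corners $\mathrm{OC}(\mu)$ of a partition $\mu$ is the set of points $(c,r)\in\mathbb{N}_0^2\setminus[\mu]$ such that ($c=0$ or $(c-1,r)\in[\mu]$) and ($r=0$ or $(c,r-1)\in[\mu]$); these are the minimal elements of $\mathbb{N}_0^2\setminus[\mu]$ for the componentwise order. For example, $\mathrm{OC}((3,2))=\{(0,2),(2,1),(3,0)\}$. For $S\subseteq\mathbb{N}_0^2$, let $\langle S\rangle=\{p\in\mathbb{N}_0^2: p\ge s \text{ componentwise for some } s\in S\}$, and let $\langle S\rangle^c=\mathbb{N}_0^2\setminus\langle S\rangle$. The coefficient $c^\lambda_{\mu^0,\dots,\mu^{n-1}}$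 is the coefficient of $s_\lambda$ in the Schur expansion of the product $s_{\mu^0}s_{\mu^1}\cdots s_{\mu^{n-1}}$. *)

theory Defs
  imports Main
begin

text \<open>A partition is a weakly decreasing list of positive naturals (no trailing zeros,
so that each partition has a unique representation).\<close>
definition is_partition :: "nat list \<Rightarrow> bool" where
  "is_partition la \<longleftrightarrow> sorted_wrt (\<ge>) la \<and> (\<forall>x\<in>set la. 0 < x)"

definition diagram :: "nat list \<Rightarrow> (nat \<times> nat) set" where
  "diagram la = {(j, i). i < length la \<and> j < la ! i}"

definition OC :: "nat list \<Rightarrow> (nat \<times> nat) set" where
  "OC mu = {(c, r). (c, r) \<notin> diagram mu
      \<and> (c = 0 \<or> (c - 1, r) \<in> diagram mu)
      \<and> (r = 0 \<or> (c, r - 1) \<in> diagram mu)}"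

definition up_closure :: "(nat \<times> nat) set \<Rightarrow> (nat \<times> nat) set" where
  "up_closure S = {p. \<exists>s\<in>S. fst s \<le> fst p \<and> snd s \<le> snd p}"

definition OC_sum :: "nat list list \<Rightarrow> (nat \<times> nat) set" where
  "OC_sum mus = {p. \<exists>ps :: (nat \<times> nat) list. length ps = length mus
      \<and> (\<forall>k < length mus. ps ! k \<in> OC (mus ! k))
      \<and> p = (sum_list (map fst ps), sum_list (map snd ps))}"

definition ssyt :: "nat list \<Rightarrow> (nat \<times> nat \<Rightarrow> nat) \<Rightarrow> bool" where
  "ssyt la T \<longleftrightarrow> (\<forall>p. p \<notin> diagram la \<longrightarrow> T p = 0)
     \<and> (\<forall>j i. (Suc j, i) \<in> diagram la \<longrightarrow> T (j, i) \<le> T (Suc j, i))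
     \<and> (\<forall>j i. (j, Suc i) \<in> diagram la \<longrightarrow> T (j, i) < T (j, Suc i))"

definition content :: "nat list \<Rightarrow> (nat \<times> nat \<Rightarrow> nat) \<Rightarrow> nat \<Rightarrow> nat" where
  "content la T v = card {p \<in> diagram la. T p = v}"

text \<open>Kostka number = coefficient of the monomial x^alpha in the Schur function s_la.\<close>
definition kostka :: "nat list \<Rightarrow> (nat \<Rightarrow> nat) \<Rightarrow> nat" where
  "kostka la alpha = card {T. ssyt la T \<and> content la T = alpha}"

text \<open>Coefficient of the monomial x^alpha in the product s_{mu^0} ... s_{mu^{n-1}}
  (tuples of tableaux with total content alpha).\<close>
definition prod_coeff :: "nat list list \<Rightarrow> (nat \<Rightarrow> nat) \<Rightarrow> nat" where
  "prod_coeff mus alpha = card {Ts :: nat \<Rightarrow> (nat \<times> nat \<Rightarrow> nat).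
      (\<forall>k < length mus. ssyt (mus ! k) (Ts k))
      \<and> (\<forall>k \<ge> length mus. Ts k = (\<lambda>_. 0))
      \<and> (\<forall>v. (\<Sum>k < length mus. content (mus ! k) (Ts k) v) = alpha v)}"

text \<open>Coefficient of s_la in the Schur expansion of s_{mu^0} ... s_{mu^{n-1}}: the unique
  family of coefficients c (supported on partitions of the total size d) with
  product = sum_nu c nu s_nu, compared monomial by monomial.\<close>
definition LR_coeff :: "nat list \<Rightarrow> nat list list \<Rightarrow> int" where
  "LR_coeff la mus =
     (let d = sum_list (map sum_list mus) in
      (THE c :: nat list \<Rightarrow> int.
         (\<forall>nu. c nu \<noteq> 0 \<longrightarrow> is_partition nu \<and> sum_list nu = d)
       \<and> (\<forall>alpha. finite {v. alpha v \<noteq> 0} \<longrightarrow>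
            int (prod_coeff mus alpha) =
            (\<Sum>nu \<in> {nu. is_partition nu \<and> sum_list nu = d}. c nu * int (kostka nu alpha))))
      la)"

end

theory Submission
  imports Defs
begin

text \<open>
  A point \<open>(c, r)\<close> lies outside \<open>[\<mu>]\<close> iff row \<open>r\<close> of \<open>\<mu>\<close> has length at most \<open>c\<close>, so the theorem is
  the inequality \<open>\<lambda> (r\<^sub>0 + \<dots> + r\<^sub>n\<^sub>-\<^sub>1) \<le> c\<^sub>0 + \<dots> + c\<^sub>n\<^sub>-\<^sub>1\<close> whenever \<open>\<mu>\<^sup>k r\<^sub>k \<le> c\<^sub>k\<close> for all \<open>k\<close>.
  Let \<open>W c r\<close> be the span of the \<open>s\<^sub>p\<close> with \<open>p r \<le> c\<close>. By the Pieri rules, multiplication by a complete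
  homogeneous \<open>h\<^sub>a\<close> maps \<open>W c r\<close> into \<open>W c (r + 1)\<close>, and multiplication by an elementary \<open>e\<^sub>a\<close> maps it
  into \<open>W (c + 1) r\<close>. Conversely, peeling off the first \<open>r\<close> rows and then the remaining at most
  \<open>c\<close> columns expresses any \<open>s\<^sub>p\<close> in \<open>W c r\<close> through products of \<open>r\<close> factors \<open>h\<close> and \<open>c\<close> factors
  \<open>e\<close>. Hence \<open>W c r \<cdot> W c' r' \<subseteq> W (c + c') (r + r')\<close>, and the Schur expansion of the product, which is
  unique, only involves \<open>\<lambda>\<close> satisfying the inequality.
\<close>

section \<open>Partitions and strips\<close>

text \<open>Partitions are handled as weakly decreasing functions that are eventually zero, so that no
  list lengths intervene when rows are compared.\<close>

definition part :: "(nat \<Rightarrow> nat) \<Rightarrow> bool" where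
  "part p \<longleftrightarrow> antimono p \<and> (\<exists>N. \<forall>i\<ge>N. p i = 0)"

definition psize :: "(nat \<Rightarrow> nat) \<Rightarrow> nat" where
  "psize p = (\<Sum>i | p i \<noteq> 0. p i)"

text \<open>The skew shape \<open>p / q\<close> then has at most one cell in each column. The
  interlacing form confines each row to an interval, which the bijections below exploit.\<close>

definition hstrip :: "(nat \<Rightarrow> nat) \<Rightarrow> (nat \<Rightarrow> nat) \<Rightarrow> bool" where
  "hstrip q p \<longleftrightarrow> (\<forall>i. q i \<le> p i \<and> p (Suc i) \<le> q i)"

definition vstrip :: "(nat \<Rightarrow> nat) \<Rightarrow> (nat \<Rightarrow> nat) \<Rightarrow> bool" where
  "vstrip q p \<longleftrightarrow> (\<forall>i. q i \<le> p i \<and> p i \<le> Suc (q i))"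

lemma psize_eq_sum_lessThan:
  assumes "\<forall>i\<ge>N. p i = 0"
  shows "psize p = sum p {..<N}"
proof -
  have "{i. p i \<noteq> 0} \<subseteq> {..<N}" using assms by (metis (mono_tags) lessThan_iff mem_Collect_eq not_le subsetI)
  then show ?thesis unfolding psize_def by (intro sum.mono_neutral_left) auto
qed

lemma part_antimonoD: "part p \<Longrightarrow> i \<le> j \<Longrightarrow> p j \<le> p i"
  by (auto simp: part_def antimono_def)

lemma partE:
  assumes "part p"
  obtains N where "\<And>M. N \<le> M \<Longrightarrow> psize p = sum p {..<M}" and "\<And>i. N \<le> i \<Longrightarrow> p i = 0"
  using assms psize_eq_sum_lessThan unfolding part_def by (metis le_trans)

lemma partI:
  assumes "\<And>i. p (Suc i) \<le> p i" "\<And>i. N \<le> i \<Longrightarrow> p i = 0"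
  shows "part p"
  using assms lift_Suc_antimono_le[of p] unfolding part_def antimono_def by blast

lemma le_psize:
  assumes "part p"
  shows "p i \<le> psize p"
proof (rule partE[OF assms])
  fix N assume N: "\<And>M. N \<le> M \<Longrightarrow> psize p = sum p {..<M}"
  have "p i \<le> sum p {..<max N (Suc i)}" by (rule member_le_sum) auto
  with N[of "max N (Suc i)"] show ?thesis by simp
qed

lemma part_psize_zero:
  assumes "part p" "psize p \<le> i"
  shows "p i = 0"
proof (rule ccontr)
  assume nz: "p i \<noteq> 0"
  obtain N where N: "\<And>M. N \<le> M \<Longrightarrow> psize p = sum p {..<M}"
    using partE[OF assms(1)] by metis
  have "Suc i = (\<Sum>j<Suc i. 1)" by simp
  also have "\<dots> \<le> sum p {..<Suc i}"
  proof (rule sum_mono)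
    fix j assume "j \<in> {..<Suc i}"
    then have "p i \<le> p j" using part_antimonoD[OF assms(1), of j i] by auto
    with nz show "1 \<le> p j" by simp
  qed
  also have "\<dots> \<le> sum p {..<max N (Suc i)}" by (rule sum_mono2) auto
  also have "\<dots> = psize p" using N[of "max N (Suc i)"] by simp
  finally show False using assms(2) by simp
qed

definition parts :: "nat \<Rightarrow> (nat \<Rightarrow> nat) set" where
  "parts d = {p. part p \<and> psize p = d}"

text \<open>A partition of \<open>d\<close> fits into a \<open>d\<close> by \<open>d\<close> square,
  since every nonempty row uses up at least one cell.\<close>

lemma finite_parts: "finite (parts d)"
proof (rule finite_subset)
  show "parts d \<subseteq> {p. \<forall>i. (i \<in> {..<d} \<longrightarrow> p i \<in> {..d}) \<and> (i \<notin> {..<d} \<longrightarrow> p i = 0)}"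
    using le_psize part_psize_zero by (auto simp: parts_def not_less)
  show "finite {p. \<forall>i. (i \<in> {..<d} \<longrightarrow> p i \<in> {..d}) \<and> (i \<notin> {..<d} \<longrightarrow> p i = (0::nat))}"
    by (rule finite_set_of_finite_funs) auto
qed

text \<open>The second claim is the tool used below to identify partitions: containment together
  with equal size.\<close>

lemma psize_mono:
  assumes "part p" "part q" "\<And>i. q i \<le> p i" 
  shows "psize q \<le> psize p" "psize q = psize p \<Longrightarrow> q = p"
proof -
  obtain N where N: "\<And>M. N \<le> M \<Longrightarrow> psize p = sum p {..<M}" "\<And>i. N \<le> i \<Longrightarrow> p i = 0"
    using partE[OF assms(1)] by metis
  have q0: "q i = 0" if "N \<le> i" for i using N(2)[OF that] assms(3)[of i] by simp
  then have q: "psize q = sum q {..<N}" using psize_eq_sum_lessThan by simp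
  show "psize q \<le> psize p" using q N(1)[of N] assms(3) by (simp add: sum_mono)
  assume "psize q = psize p"
  then have "sum q {..<N} = sum p {..<N}" using q N(1)[of N] by simp
  then have "\<forall>i<N. q i = p i" using sum_mono_inv[of q "{..<N}" p] assms(3) by auto
  then show "q = p" using q0 N(2) by (metis ext linorder_not_le)
qed

definition addh :: "nat \<Rightarrow> (nat \<Rightarrow> nat) \<Rightarrow> (nat \<Rightarrow> nat) set" where
  "addh a p = {l. part l \<and> hstrip p l \<and> psize l = psize p + a}"

definition remh :: "nat \<Rightarrow> (nat \<Rightarrow> nat) \<Rightarrow> (nat \<Rightarrow> nat) set" where
  "remh a p = {l. part l \<and> hstrip l p \<and> psize p = psize l + a}"

definition addv :: "nat \<Rightarrow> (nat \<Rightarrow> nat) \<Rightarrow> (nat \<Rightarrow> nat) set" where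
  "addv a p = {l. part l \<and> vstrip p l \<and> psize l = psize p + a}"

lemma finite_addh [simp]: "finite (addh a p)"
  by (rule finite_subset[OF _ finite_parts[of "psize p + a"]]) (auto simp: addh_def parts_def)

lemma finite_addv [simp]: "finite (addv a p)"
  by (rule finite_subset[OF _ finite_parts[of "psize p + a"]]) (auto simp: addv_def parts_def)

lemma finite_remh [simp]: "finite (remh a p)"
  by (rule finite_subset[OF _ finite_parts[of "psize p - a"]]) (auto simp: remh_def parts_def)

section \<open>Schur functions and their products\<close>

text \<open>Formal series are given by their coefficients at exponent lists. The head of the list is the
  exponent of the largest letter, whose cells form the horizontal strip that is removed first.\<close>

fun schur :: "(nat \<Rightarrow> nat) \<Rightarrow> nat list \<Rightarrow> int" where
  "schur p [] = of_bool (p = (\<lambda>_. 0))"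
| "schur p (n # xs) = (\<Sum>q\<in>remh n p. schur q xs)"

text \<open>The product of formal series: at each letter the exponent is shared out between the two
  factors.\<close>

fun conv :: "(nat list \<Rightarrow> int) \<Rightarrow> (nat list \<Rightarrow> int) \<Rightarrow> nat list \<Rightarrow> int" where
  "conv f g [] = f [] * g []"
| "conv f g (n # xs) = (\<Sum>i\<le>n. conv (\<lambda>ys. f (i # ys)) (\<lambda>ys. g ((n - i) # ys)) xs)"

lemma conv_sum_left: "conv (\<lambda>ys. \<Sum>p\<in>A. f p ys) g xs = (\<Sum>p\<in>A. conv (f p) g xs)"
proof (induction xs arbitrary: f g)
  case (Cons n xs)
  then show ?case by (simp add: sum.swap[of _ A])
qed (simp add: sum_distrib_right)

lemma conv_sum_right: "conv f (\<lambda>ys. \<Sum>p\<in>A. g p ys) xs = (\<Sum>p\<in>A. conv f (g p) xs)"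
proof (induction xs arbitrary: f g)
  case (Cons n xs)
  then show ?case by (simp add: sum.swap[of _ A])
qed (simp add: sum_distrib_left)

lemma conv_scale_left: "conv (\<lambda>ys. c * f ys) g xs = c * conv f g xs"
  by (induction xs arbitrary: f g) (simp_all add: sum_distrib_left)

lemma conv_scale_right: "conv f (\<lambda>ys. c * g ys) xs = c * conv f g xs"
  by (induction xs arbitrary: f g) (simp_all add: sum_distrib_left)

lemma conv_zero_left: "conv (\<lambda>_. 0) g xs = 0"
  by (induction xs arbitrary: g) simp_all

lemma conv_assoc: "conv (conv f g) h xs = conv f (conv g h) xs"
proof (induction xs arbitrary: f g h)
  case (Cons n xs)
  have "conv (conv f g) h (n # xs) =
      (\<Sum>i\<le>n. \<Sum>j\<le>i. conv (\<lambda>ys. f (j # ys))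
        (conv (\<lambda>ys. g ((i - j) # ys)) (\<lambda>ys. h ((n - i) # ys))) xs)"
    by (simp add: conv_sum_left Cons.IH)
  also have "\<dots> = (\<Sum>j\<le>n. \<Sum>k\<le>n-j. conv (\<lambda>ys. f (j # ys))
        (conv (\<lambda>ys. g (k # ys)) (\<lambda>ys. h ((n - j - k) # ys))) xs)"
    unfolding sum.Sigma[OF finite_atMost ballI[OF finite_atMost]]
    by (rule sum.reindex_bij_witness[where
          i = "\<lambda>(j, k). (j + k, j)" and j = "\<lambda>(i, j). (j, i - j)"]) auto
  also have "\<dots> = conv f (conv g h) (n # xs)"
    by (simp add: conv_sum_right)
  finally show ?case .
qed simp

section \<open>Pieri rules\<close>

text \<open>The complete homogeneous function \<open>h_a\<close>, in which every monomial of degree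
  \<open>a\<close> has coefficient 1.\<close>

definition hcoeff :: "nat \<Rightarrow> nat list \<Rightarrow> int" where
  "hcoeff a xs = of_bool (sum_list xs = a)"

lemma hcoeff_Cons: "hcoeff a (i # ys) = (if i \<le> a then hcoeff (a - i) ys else 0)"
  by (auto simp: hcoeff_def)

lemma schur_empty: "schur (\<lambda>_. 0) xs = of_bool (sum_list xs = 0)"
proof (induction xs)
  case (Cons n xs)
  have "remh n (\<lambda>_. 0) = (if n = 0 then {\<lambda>_. 0} else {})"
    by (auto simp: remh_def hstrip_def psize_def part_def antimono_def)
  with Cons show ?case by simp
qed simp

text \<open>The local form of the Cauchy identity: for fixed \<open>\<mu>\<close> and \<open>\<kappa>\<close>, the rows of a partition
  \<open>\<lambda>\<close> above both and of a partition \<open>\<tau>\<close> below both vary independently in the same intervals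
  \<open>[max (\<mu> (i+1)) (\<kappa> (i+1)), min (\<mu> i) (\<kappa> i)]\<close>, except for the unbounded first row of \<open>\<lambda>\<close>.\<close>

definition flip_up :: "(nat \<Rightarrow> nat) \<Rightarrow> (nat \<Rightarrow> nat) \<Rightarrow> nat \<Rightarrow> (nat \<Rightarrow> nat) \<Rightarrow> nat \<Rightarrow> nat" where
  "flip_up m k b t i = (case i of 0 \<Rightarrow> max (m 0) (k 0) + b
     | Suc i \<Rightarrow> max (m (Suc i)) (k (Suc i)) + min (m i) (k i) - t i)"

definition flip_down :: "(nat \<Rightarrow> nat) \<Rightarrow> (nat \<Rightarrow> nat) \<Rightarrow> (nat \<Rightarrow> nat) \<Rightarrow> nat \<Rightarrow> nat" where
  "flip_down m k l i = max (m (Suc i)) (k (Suc i)) + min (m i) (k i) - l (Suc i)"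

lemma hstrip_below_iff:
  "hstrip t m \<and> hstrip t k \<longleftrightarrow> (\<forall>i. max (m (Suc i)) (k (Suc i)) \<le> t i \<and> t i \<le> min (m i) (k i))"
  by (auto simp: hstrip_def)

lemma hstrip_above_iff:
  "hstrip m l \<and> hstrip k l \<longleftrightarrow> max (m 0) (k 0) \<le> l 0 \<and>
     (\<forall>i. max (m (Suc i)) (k (Suc i)) \<le> l (Suc i) \<and> l (Suc i) \<le> min (m i) (k i))"
  unfolding hstrip_def by (metis (no_types, lifting) max.bounded_iff min.bounded_iff not0_implies_Suc)

lemma psize_Suc_shift:
  assumes "part p"
  shows "psize p = p 0 + psize (\<lambda>i. p (Suc i))"
proof -
  obtain N where N: "\<And>i. N \<le> i \<Longrightarrow> p i = 0" using partE[OF assms] by metis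
  have "psize p = sum p {..<Suc N}" "psize (\<lambda>i. p (Suc i)) = (\<Sum>i<N. p (Suc i))"
    by (rule psize_eq_sum_lessThan; use N in auto)+
  then show ?thesis by (simp only: sum.lessThan_Suc_shift)
qed

text \<open>Since \<open>max x y + min x y = x + y\<close>, the interval ends add up to the cells of
  \<open>m\<close> and \<open>k\<close>; the surplus \<open>b\<close> is what \<open>l 0\<close> has
  beyond its lower bound.\<close>

lemma psize_flip:
  assumes "part m" "part k" "part t" "part l"
    and t: "\<And>i. t i + l (Suc i) = max (m (Suc i)) (k (Suc i)) + min (m i) (k i)"
    and l: "l 0 = max (m 0) (k 0) + b"
  shows "psize t + psize l = psize m + psize k + b"
proof -
  obtain N1 where N1: "\<And>i. N1 \<le> i \<Longrightarrow> m i = 0" using partE[OF assms(1)] by metis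
  obtain N2 where N2: "\<And>i. N2 \<le> i \<Longrightarrow> k i = 0" using partE[OF assms(2)] by metis
  obtain N3 where N3: "\<And>i. N3 \<le> i \<Longrightarrow> t i = 0" using partE[OF assms(3)] by metis
  obtain N4 where N4: "\<And>i. N4 \<le> i \<Longrightarrow> l i = 0" using partE[OF assms(4)] by metis
  define N where "N = N1 + N2 + N3 + N4"
  have mN: "m N = 0" by (simp add: N1 N_def)
  have sizes: "psize t = sum t {..<N}" "psize l = sum l {..<Suc N}"
    "psize m = sum m {..<Suc N}" "psize k = sum k {..<Suc N}"
    by (rule psize_eq_sum_lessThan; use N1 N2 N3 N4 in \<open>auto simp: N_def\<close>)+
  have "sum t {..<N} + sum l {..<Suc N} = l 0 + (\<Sum>i<N. t i + l (Suc i))"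
    by (simp only: sum.lessThan_Suc_shift sum.distrib ac_simps)
  also have "\<dots> = (max (m 0) (k 0) + (\<Sum>i<N. max (m (Suc i)) (k (Suc i)))) + (\<Sum>i<N. min (m i) (k i)) + b"
    by (simp only: t l sum.distrib ac_simps)
  \<comment> \<open>The maxima, shifted by one row, absorb the term of row 0; extending the minima
    to row \<open>N\<close> costs nothing because \<open>m N = 0\<close>.\<close>
  also have "\<dots> = (\<Sum>i<Suc N. max (m i) (k i)) + (\<Sum>i<Suc N. min (m i) (k i)) + b"
    by (simp only: sum.lessThan_Suc_shift[of "\<lambda>i. max (m i) (k i)"]) (simp add: mN)
  also have "\<dots> = (\<Sum>i<Suc N. m i + k i) + b"
  proof -
    have "max (m i) (k i) + min (m i) (k i) = m i + k i" for i by linarith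
    then show ?thesis by (simp only: sum.distrib[symmetric])
  qed
  also have "\<dots> = sum m {..<Suc N} + sum k {..<Suc N} + b" by (simp only: sum.distrib)
  finally show ?thesis by (simp only: sizes)
qed

lemma part_hstrip_above:
  assumes "part m" "hstrip m l"
  shows "part l"
proof -
  obtain N where N: "\<And>i. N \<le> i \<Longrightarrow> m i = 0" using partE[OF assms(1)] by metis
  show ?thesis
  proof (rule partI[of l "Suc N"])
    show "l (Suc i) \<le> l i" for i using assms(2) unfolding hstrip_def by (meson le_trans)
    show "l i = 0" if "Suc N \<le> i" for i
      using that assms(2) N[of "i - 1"] unfolding hstrip_def
      by (metis Suc_le_D Suc_le_mono diff_Suc_1 le_zero_eq)
  qed
qed

lemma part_hstrip_below:
  assumes "part m" "hstrip t m"
  shows "part t"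
proof -
  obtain N where N: "\<And>i. N \<le> i \<Longrightarrow> m i = 0" using partE[OF assms(1)] by metis
  show ?thesis
  proof (rule partI[of t N])
    show "t (Suc i) \<le> t i" for i using assms(2) unfolding hstrip_def by (meson le_trans)
    show "t i = 0" if "N \<le> i" for i
      using that assms(2) N[of i] unfolding hstrip_def by (metis le_zero_eq)
  qed
qed

text \<open>Reflecting a row in its interval keeps it there, so the interlacing survives, and
  reflecting twice is the identity. The free first row stores \<open>i\<close>, the share of the
  exponent \<open>n\<close> that goes to \<open>h_a\<close>.\<close>

lemma flip_up:
  assumes m: "part m" and t: "t \<in> remh (n - i) m" and k: "k \<in> addh (a - i) t"
    and i: "i \<le> n" "i \<le> a"
  shows "flip_up m k i t \<in> addh a m" "k \<in> remh n (flip_up m k i t)"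
    "flip_up m k i t 0 - max (m 0) (k 0) = i" "flip_down m k (flip_up m k i t) = t"
proof -
  let ?l = "flip_up m k i t"
  have b: "max (m (Suc j)) (k (Suc j)) \<le> t j" "t j \<le> min (m j) (k j)" for j
    using hstrip_below_iff[of t m k] t k by (auto simp: remh_def addh_def)
  have l: "t j + ?l (Suc j) = max (m (Suc j)) (k (Suc j)) + min (m j) (k j)" for j
    unfolding flip_up_def nat.case using b(2)[of j] by linarith
  have l0: "?l 0 = max (m 0) (k 0) + i" by (simp add: flip_up_def)
  have "hstrip m ?l \<and> hstrip k ?l"
    unfolding hstrip_above_iff
  proof (intro conjI allI)
    fix j
    show "max (m (Suc j)) (k (Suc j)) \<le> ?l (Suc j)" "?l (Suc j) \<le> min (m j) (k j)"
      using b[of j] l[of j] by linarith+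
  qed (simp add: l0)
  then have h: "hstrip m ?l" "hstrip k ?l" by auto
  have p: "part ?l" "part t" "part k" using part_hstrip_above[OF m h(1)] t k by (auto simp: remh_def addh_def)
  have "psize t + psize ?l = psize m + psize k + i"
    by (rule psize_flip[OF m p(3,2,1) l l0])
  then show "?l \<in> addh a m" "k \<in> remh n ?l"
    using h p t k i by (auto simp: remh_def addh_def)
  show "?l 0 - max (m 0) (k 0) = i" using l0 by simp
  show "flip_down m k ?l = t"
  proof
    fix j show "flip_down m k ?l j = t j"
      unfolding flip_down_def using l[of j] by linarith
  qed
qed

lemma flip_down:
  assumes m: "part m" and l: "l \<in> addh a m" and k: "k \<in> remh n l"
  shows "flip_down m k l \<in> remh (n - (l 0 - max (m 0) (k 0))) m"
    "k \<in> addh (a - (l 0 - max (m 0) (k 0))) (flip_down m k l)"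
    "l 0 - max (m 0) (k 0) \<le> n" "l 0 - max (m 0) (k 0) \<le> a"
    "flip_up m k (l 0 - max (m 0) (k 0)) (flip_down m k l) = l"
proof -
  let ?t = "flip_down m k l" and ?i = "l 0 - max (m 0) (k 0)"
  have b: "max (m 0) (k 0) \<le> l 0" "max (m (Suc j)) (k (Suc j)) \<le> l (Suc j)"
    "l (Suc j) \<le> min (m j) (k j)" for j
    using hstrip_above_iff[of m l k] l k by (auto simp: remh_def addh_def)
  have t: "?t j + l (Suc j) = max (m (Suc j)) (k (Suc j)) + min (m j) (k j)" for j
    unfolding flip_down_def using b(3)[of j] by linarith
  have l0: "l 0 = max (m 0) (k 0) + ?i" using b(1) by simp
  have "hstrip ?t m \<and> hstrip ?t k"
    unfolding hstrip_below_iff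
  proof (intro conjI allI)
    fix j
    show "max (m (Suc j)) (k (Suc j)) \<le> ?t j" "?t j \<le> min (m j) (k j)"
      using b(2,3)[of j] t[of j] by linarith+
  qed
  then have h: "hstrip ?t m" "hstrip ?t k" by auto
  have p: "part ?t" "part l" "part k" using part_hstrip_below[OF m h(1)] l k by (auto simp: remh_def addh_def)
  have s: "psize ?t + psize l = psize m + psize k + ?i"
    by (rule psize_flip[OF m p(3,1,2) t l0])
  \<comment> \<open>These containments, with the size identity \<open>s\<close>, bound the recovered
    share by \<open>n\<close> and by \<open>a\<close>.\<close>
  have "psize ?t \<le> psize m" "psize ?t \<le> psize k"
    using psize_mono(1)[OF m p(1)] psize_mono(1)[OF p(3) p(1)] h
    by (auto simp: hstrip_def)
  moreover have "psize l = psize m + a" "psize l = psize k + n" using l k by (auto simp: remh_def addh_def)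
  ultimately show "?i \<le> n" "?i \<le> a" "?t \<in> remh (n - ?i) m" "k \<in> addh (a - ?i) ?t"
    using s h p unfolding remh_def addh_def by auto
  show "flip_up m k ?i ?t = l"
  proof
    fix j show "flip_up m k ?i ?t j = l j"
      using b(1) b(2,3)[of "j - 1"] by (cases j) (auto simp: flip_down_def flip_up_def)
  qed
qed

text \<open>Induction on the number of letters. Splitting off the largest letter leaves on the left
  a share \<open>i\<close>, a strip removed from \<open>m\<close> and a strip added to the result;
  on the right a strip is added first and one removed afterwards. \<open>flip_up\<close> and
  \<open>flip_down\<close> match the two sides with the same final shape \<open>k\<close>.\<close>

lemma pieri_h:
  assumes "part m"
  shows "conv (hcoeff a) (schur m) xs = (\<Sum>l\<in>addh a m. schur l xs)"
  using assms
proof (induction xs arbitrary: a m)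
  case Nil
  have "(\<Sum>l\<in>addh a m. schur l []) = (\<Sum>l\<in>addh a m \<inter> {\<lambda>_. 0}. 1)"
    by (simp add: Int_commute sum.inter_filter of_bool_def flip: sum.inter_restrict)
  also have "\<dots> = of_bool (a = 0 \<and> m = (\<lambda>_. 0))"
  proof -
    have "addh a m \<inter> {\<lambda>_. 0} = (if a = 0 \<and> m = (\<lambda>_. 0) then {\<lambda>_. 0} else {})"
      by (auto simp: addh_def hstrip_def psize_def part_def antimono_def fun_eq_iff)
    then show ?thesis by simp
  qed
  finally show ?case by (simp add: hcoeff_def)
next
  case (Cons n xs)
  have "conv (hcoeff a) (schur m) (n # xs) =
      (\<Sum>i\<le>n. if i \<le> a then (\<Sum>t\<in>remh (n - i) m. \<Sum>k\<in>addh (a - i) t. schur k xs) else 0)"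
    unfolding conv.simps
  proof (rule sum.cong[OF refl])
    fix i
    show "conv (\<lambda>ys. hcoeff a (i # ys)) (\<lambda>ys. schur m ((n - i) # ys)) xs
      = (if i \<le> a then (\<Sum>t\<in>remh (n - i) m. \<Sum>k\<in>addh (a - i) t. schur k xs) else 0)"
      by (simp add: hcoeff_Cons conv_zero_left conv_sum_right Cons.IH remh_def)
  qed
  also have "\<dots> = (\<Sum>i\<in>{i. i \<le> n \<and> i \<le> a}. \<Sum>t\<in>remh (n - i) m. \<Sum>k\<in>addh (a - i) t. schur k xs)"
    by (rule sum.mono_neutral_cong_right) auto
  also have "\<dots> = (\<Sum>(i, t, k)\<in>(SIGMA i:{i. i \<le> n \<and> i \<le> a}. SIGMA t:remh (n - i) m. addh (a - i) t). schur k xs)"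
    by (simp add: sum.Sigma)
  also have "\<dots> = (\<Sum>(l, k)\<in>(SIGMA l:addh a m. remh n l). schur k xs)"
    by (rule sum.reindex_bij_witness[where j = "\<lambda>(i, t, k). (flip_up m k i t, k)" and
          i = "\<lambda>(l, k). (l 0 - max (m 0) (k 0), flip_down m k l, k)"])
      (auto simp: flip_up[OF Cons.prems] flip_down[OF Cons.prems])
  also have "\<dots> = (\<Sum>l\<in>addh a m. schur l (n # xs))"
    by (simp add: sum.Sigma)
  finally show ?case .
qed

section \<open>Elementary symmetric functions and their Pieri rule\<close>

lemma hcoeff_0_conv: "conv (hcoeff 0) f xs = f xs"
proof (induction xs arbitrary: f)
  case (Cons n xs)
  have "conv (hcoeff 0) f (n # xs) = (\<Sum>i\<le>n. if i = 0 then conv (hcoeff 0) (\<lambda>ys. f ((n - i) # ys)) xs else 0)"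
    unfolding conv.simps by (intro sum.cong) (auto simp: hcoeff_Cons conv_zero_left)
  with Cons show ?case by simp
qed (simp add: hcoeff_def)

text \<open>The recursion is \<open>\<Sum>i\<le>n. (-1)^i e\<^sub>n\<^sub>-\<^sub>i h\<^sub>i = 0\<close>. It reduces the Pieri rule for \<open>e\<close> to the one for
  \<open>h\<close> and a sign-reversing involution.\<close>

fun ecoeff :: "nat \<Rightarrow> nat list \<Rightarrow> int" where
  "ecoeff 0 = hcoeff 0"
| "ecoeff (Suc n) = (\<lambda>xs. \<Sum>i\<le>n. (-1) ^ i * conv (ecoeff (n - i)) (hcoeff (Suc i)) xs)"

text \<open>In the first row where \<open>l\<close> and \<open>m\<close> differ, the intermediate partition of a horizontal strip
  followed by a vertical strip has exactly two possible lengths.\<close>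

definition toggle :: "(nat \<Rightarrow> nat) \<Rightarrow> (nat \<Rightarrow> nat) \<Rightarrow> (nat \<Rightarrow> nat) \<Rightarrow> nat \<Rightarrow> nat" where
  "toggle m l v = (let i = (LEAST i. l i \<noteq> m i) in v(i := if v i = l i then l i - 1 else l i))"

text \<open>In the first differing row \<open>i\<close>, \<open>m i < l i\<close>, and
  \<open>vstrip\<close> leaves \<open>v i\<close> the values \<open>l i\<close> and
  \<open>l i - 1\<close>. Both respect \<open>hstrip\<close>: for \<open>i > 0\<close>, row
  \<open>i - 1\<close> of \<open>l\<close> agrees with that of \<open>m\<close>, so
  \<open>l i \<le> m (i - 1)\<close>.\<close>

lemma toggle:
  assumes m: "part m" and h: "hstrip m v" "vstrip v l" and ne: "l \<noteq> m" and pv: "part v" and pl: "part l"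
  shows "part (toggle m l v)" "hstrip m (toggle m l v)" "vstrip (toggle m l v) l"
    "toggle m l (toggle m l v) = v"
    "psize (toggle m l v) = Suc (psize v) \<or> psize v = Suc (psize (toggle m l v))"
proof -
  define i where "i = (LEAST i. l i \<noteq> m i)"
  have "\<exists>i. l i \<noteq> m i" using ne by auto
  then have i: "l i \<noteq> m i" and less: "\<And>j. j < i \<Longrightarrow> l j = m j"
    unfolding i_def by (rule LeastI_ex) (auto dest: not_less_Least)
  have mv: "m j \<le> v j" "v (Suc j) \<le> m j" "v j \<le> l j" "l j \<le> Suc (v j)" for j
    using h by (auto simp: hstrip_def vstrip_def)
  have gt: "m i < l i" using mv(1,3)[of i] i by linarith
  have vi: "v i = l i \<or> v i = l i - 1" using mv(3,4)[of i] by linarith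
  have t: "toggle m l v j = (if j = i then (if v i = l i then l i - 1 else l i) else v j)" for j
    by (simp add: toggle_def Let_def i_def)
  have up: "l (Suc j) \<le> m j" if "Suc j = i" for j
    using less[of j] that part_antimonoD[OF pl, of j "Suc j"] by simp
  show hs: "hstrip m (toggle m l v)"
    unfolding hstrip_def
  proof
    fix j show "m j \<le> toggle m l v j \<and> toggle m l v (Suc j) \<le> m j"
      using mv(1,2)[of j] gt up[of j] by (auto simp: t)
  qed
  then show "part (toggle m l v)" by (rule part_hstrip_above[OF m])
  show "vstrip (toggle m l v) l"
    unfolding vstrip_def
  proof
    fix j show "toggle m l v j \<le> l j \<and> l j \<le> Suc (toggle m l v j)"
      using mv(3,4)[of j] gt by (auto simp: t)
  qed
  show "toggle m l (toggle m l v) = v"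
  proof
    fix j show "toggle m l (toggle m l v) j = v j"
      using vi gt by (auto simp: t[of j] toggle_def Let_def i_def[symmetric])
  qed
  obtain N where N: "\<And>j. N \<le> j \<Longrightarrow> v j = 0" using partE[OF pv] by metis
  have *: "psize w = w i + sum v ({..<N + Suc i} - {i})" if "\<And>j. j \<noteq> i \<Longrightarrow> w j = v j" for w
  proof -
    have "psize w = sum w {..<N + Suc i}"
      by (rule psize_eq_sum_lessThan) (use N that in auto)
    also have "\<dots> = w i + sum w ({..<N + Suc i} - {i})" by (rule sum.remove) auto
    also have "sum w ({..<N + Suc i} - {i}) = sum v ({..<N + Suc i} - {i})"
      by (rule sum.cong) (use that in auto)
    finally show ?thesis .
  qed
  show "psize (toggle m l v) = Suc (psize v) \<or> psize v = Suc (psize (toggle m l v))"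
    using *[of v] *[of "toggle m l v"] vi gt by (auto simp: t)
qed

lemma addh_0: "part m \<Longrightarrow> addh 0 m = {m}"
  by (auto simp: addh_def hstrip_def part_antimonoD dest: psize_mono(2)[of _ m])

lemma addv_0: "part m \<Longrightarrow> addv 0 m = {m}"
  by (auto simp: addv_def vstrip_def dest: psize_mono(2)[of _ m])

text \<open>Each pair \<open>(v, l)\<close> carries the sign given by the size of
  \<open>v / m\<close>. The positive total size forces \<open>l \<noteq> m\<close>, so
  \<open>toggle\<close> applies; it keeps \<open>l\<close> and changes the size of \<open>v\<close>
  by one, so the sum equals its own negative.\<close>

lemma alternating_strips:
  assumes m: "part m"
  shows "(\<Sum>i\<le>Suc n. (-1) ^ i * (\<Sum>v\<in>addh i m. \<Sum>l\<in>addv (Suc n - i) v. schur l xs)) = 0"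
proof -
  define Q where "Q = {(v, l). part v \<and> part l \<and> hstrip m v \<and> vstrip v l \<and> psize l = psize m + Suc n}"
  have le: "psize m \<le> psize v" if "part v" "hstrip m v" for v
    using psize_mono(1)[OF that(1) m] that(2) by (auto simp: hstrip_def)
  have le': "psize v \<le> psize l" if "part v" "part l" "vstrip v l" for v l
    using psize_mono(1)[OF that(2,1)] that(3) by (auto simp: vstrip_def)
  have "(\<Sum>i\<le>Suc n. (-1) ^ i * (\<Sum>v\<in>addh i m. \<Sum>l\<in>addv (Suc n - i) v. schur l xs)) =
     (\<Sum>(i, v, l)\<in>(SIGMA i:{..Suc n}. SIGMA v:addh i m. addv (Suc n - i) v). (-1) ^ i * schur l xs)"
    by (simp add: sum.Sigma sum_distrib_left case_prod_unfold del: sum.atMost_Suc)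
  also have "\<dots> = (\<Sum>(v, l)\<in>Q. (-1) ^ (psize v - psize m) * schur l xs)"
  proof (rule sum.reindex_bij_witness[where j = "\<lambda>(i, v, l). (v, l)" and
        i = "\<lambda>(v, l). (psize v - psize m, v, l)"], goal_cases)
    case (4 b)
    then obtain v l where "b = (v, l)" "(v, l) \<in> Q" by (cases b) auto
    with le[of v] le'[of v l] show ?case by (auto simp: Q_def addh_def addv_def)
  qed (auto simp: Q_def addh_def addv_def)
  also have "\<dots> = 0"
  proof -
    have ne: "l \<noteq> m" if "(v, l) \<in> Q" for v l using that by (auto simp: Q_def)
    have "(\<Sum>(v, l)\<in>Q. (-1) ^ (psize v - psize m) * schur l xs) =
       (\<Sum>(v, l)\<in>Q. - ((-1) ^ (psize v - psize m) * schur l xs))"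
    proof (rule sum.reindex_bij_witness[where j = "\<lambda>(v, l). (toggle m l v, l)" and
          i = "\<lambda>(v, l). (toggle m l v, l)"], goal_cases)
      case (5 a)
      then obtain v l where a: "a = (v, l)" "(v, l) \<in> Q" by (cases a) auto
      then have q: "hstrip m v" "vstrip v l" "part v" "part l" by (auto simp: Q_def)
      note T = toggle[OF m q(1,2) ne[OF a(2)] q(3,4)]
      from T(5) le[OF q(3,1)] le[OF T(1,2)]
      have "psize (toggle m l v) - psize m = Suc (psize v - psize m)
         \<or> psize v - psize m = Suc (psize (toggle m l v) - psize m)" by linarith
      then show ?case by (auto simp: a)
    qed (use toggle[OF m] ne in \<open>force simp: Q_def\<close>)+
    then show ?thesis by (simp add: case_prod_unfold sum_negf)
  qed
  finally show ?thesis .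
qed

lemma conv_hcoeff_schur:
  "part m \<Longrightarrow> conv (hcoeff a) (schur m) = (\<lambda>xs. \<Sum>l\<in>addh a m. schur l xs)"
  using pieri_h by (intro ext)

text \<open>The recursion puts \<open>h\<close> next to \<open>schur m\<close>, so the Pieri rule
  for \<open>h\<close> applies first and the induction hypothesis afterwards. Up to sign this yields
  the alternating sum of \<open>alternating_strips\<close> without its term \<open>i = 0\<close>,
  and that term is the right-hand side.\<close>

lemma pieri_e:
  assumes "part m"
  shows "conv (ecoeff n) (schur m) xs = (\<Sum>l\<in>addv n m. schur l xs)"
  using assms
proof (induction n arbitrary: m rule: less_induct)
  case (less n)
  show ?case
  proof (cases n)
    case 0
    then show ?thesis using less.prems by (simp add: hcoeff_0_conv addv_0)
  next
    case (Suc k)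
    let ?g = "\<lambda>i. (-1) ^ i * (\<Sum>v\<in>addh i m. \<Sum>l\<in>addv (Suc k - i) v. schur l xs)"
    have "conv (ecoeff n) (schur m) xs = (\<Sum>i\<le>k. (-1) ^ i *
        (\<Sum>v\<in>addh (Suc i) m. conv (ecoeff (k - i)) (schur v) xs))"
      by (simp add: Suc conv_sum_left conv_scale_left conv_assoc conv_hcoeff_schur[OF less.prems]
          conv_sum_right)
    also have "\<dots> = (\<Sum>i\<le>k. - ?g (Suc i))"
    proof (rule sum.cong[OF refl])
      fix i assume "i \<in> {..k}"
      have "(\<Sum>v\<in>addh (Suc i) m. conv (ecoeff (k - i)) (schur v) xs) =
        (\<Sum>v\<in>addh (Suc i) m. \<Sum>l\<in>addv (k - i) v. schur l xs)"
        by (rule sum.cong[OF refl], rule less.IH) (auto simp: Suc addh_def)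
      then show "(-1) ^ i * (\<Sum>v\<in>addh (Suc i) m. conv (ecoeff (k - i)) (schur v) xs) = - ?g (Suc i)"
        by simp
    qed
    also have "\<dots> = ?g 0"
      using alternating_strips[OF less.prems, of xs k]
      unfolding sum.atMost_Suc_shift sum_negf by linarith
    finally show ?thesis using less.prems by (simp add: Suc addh_0)
  qed
qed

lemma conv_ecoeff_schur:
  "part m \<Longrightarrow> conv (ecoeff a) (schur m) = (\<lambda>xs. \<Sum>l\<in>addv a m. schur l xs)"
  using pieri_e by (intro ext)

section \<open>Schur functions with a cell outside the shape\<close>

text \<open>The degree \<open>d\<close> part of \<open>W c r\<close>, with integer coefficients;
  fixing the degree keeps the sums finite. The condition \<open>p r \<le> c\<close> confines
  \<open>p\<close> to the first \<open>r\<close> rows and the first \<open>c\<close> columns, a fat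
  hook.\<close>

definition hook_span :: "nat \<Rightarrow> nat \<Rightarrow> nat \<Rightarrow> (nat list \<Rightarrow> int) set" where
  "hook_span c r d = {f. \<exists>a. f = (\<lambda>xs. \<Sum>p | p \<in> parts d \<and> p r \<le> c. a p * schur p xs)}"

lemma hook_span_zero: "(\<lambda>_. 0) \<in> hook_span c r d"
  unfolding hook_span_def by (intro CollectI exI[of _ "\<lambda>_. 0"]) simp

lemma hook_span_add:
  "f \<in> hook_span c r d \<Longrightarrow> g \<in> hook_span c r d \<Longrightarrow> (\<lambda>xs. f xs + g xs) \<in> hook_span c r d"
  unfolding hook_span_def
  by (safe, rule_tac x = "\<lambda>p. a p + aa p" in exI) (simp add: distrib_right sum.distrib)

lemma hook_span_scale: "f \<in> hook_span c r d \<Longrightarrow> (\<lambda>xs. k * f xs) \<in> hook_span c r d"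
  unfolding hook_span_def
  by (safe, rule_tac x = "\<lambda>p. k * a p" in exI) (simp add: sum_distrib_left mult.assoc)

lemma hook_span_diff:
  assumes "f \<in> hook_span c r d" "g \<in> hook_span c r d"
  shows "(\<lambda>xs. f xs - g xs) \<in> hook_span c r d"
  using hook_span_add[OF assms(1) hook_span_scale[OF assms(2), of "-1"]] by simp

lemma hook_span_sum:
  assumes "\<And>i. i \<in> A \<Longrightarrow> f i \<in> hook_span c r d"
  shows "(\<lambda>xs. \<Sum>i\<in>A. f i xs) \<in> hook_span c r d"
  using assms
proof (induction A rule: infinite_finite_induct)
  case (insert x F)
  then show ?case using hook_span_add[of "f x" c r d "\<lambda>xs. \<Sum>i\<in>F. f i xs"] by simp
qed (auto simp: hook_span_zero)

lemma schur_in_hook_span: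
  assumes "p \<in> parts d" "p r \<le> c"
  shows "schur p \<in> hook_span c r d"
  unfolding hook_span_def
proof (intro CollectI exI ext)
  fix xs
  have "(\<Sum>q | q \<in> parts d \<and> q r \<le> c. of_bool (q = p) * schur q xs) =
     (\<Sum>q\<in>{p}. of_bool (q = p) * schur q xs)"
    by (rule sum.mono_neutral_right) (use assms finite_parts in auto)
  then show "schur p xs = (\<Sum>q | q \<in> parts d \<and> q r \<le> c. of_bool (q = p) * schur q xs)" by simp
qed

lemma hook_span_conv:
  assumes "f \<in> hook_span c r d"
    and "\<And>p. p \<in> parts d \<Longrightarrow> p r \<le> c \<Longrightarrow> conv h (schur p) \<in> hook_span c' r' d'"
  shows "conv h f \<in> hook_span c' r' d'"
proof -
  obtain a where f: "f = (\<lambda>xs. \<Sum>p | p \<in> parts d \<and> p r \<le> c. a p * schur p xs)"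
    using assms(1) by (auto simp: hook_span_def)
  have "conv h f = (\<lambda>xs. \<Sum>p | p \<in> parts d \<and> p r \<le> c. a p * conv h (schur p) xs)"
    by (rule ext) (simp add: f conv_sum_right conv_scale_right)
  also have "\<dots> \<in> hook_span c' r' d'"
    by (intro hook_span_sum hook_span_scale assms(2)) auto
  finally show ?thesis .
qed

text \<open>Adding a horizontal strip gives \<open>l (Suc r) \<le> p r\<close>, so the bound passes
  to the next row.\<close>

lemma hcoeff_hook_span:
  assumes "f \<in> hook_span c r d"
  shows "conv (hcoeff a) f \<in> hook_span c (Suc r) (d + a)"
proof (rule hook_span_conv[OF assms])
  fix p assume p: "p \<in> parts d" "p r \<le> c"
  then have "part p" "psize p = d" by (auto simp: parts_def)
  then show "conv (hcoeff a) (schur p) \<in> hook_span c (Suc r) (d + a)"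
    using p unfolding conv_hcoeff_schur[OF \<open>part p\<close>]
    by (intro hook_span_sum schur_in_hook_span)
      (auto simp: addh_def parts_def hstrip_def intro: le_trans)
qed

text \<open>A vertical strip lengthens row \<open>r\<close> by at most one cell.\<close>

lemma ecoeff_hook_span:
  assumes "f \<in> hook_span c r d"
  shows "conv (ecoeff a) f \<in> hook_span (Suc c) r (d + a)"
proof (rule hook_span_conv[OF assms])
  fix p assume p: "p \<in> parts d" "p r \<le> c"
  then have *: "part p" "psize p = d" by (auto simp: parts_def)
  have "conv (ecoeff a) (schur p) = (\<lambda>xs. \<Sum>l\<in>addv a p. schur l xs)"
    by (rule conv_ecoeff_schur[OF *(1)])
  also have "\<dots> \<in> hook_span (Suc c) r (d + a)"
  proof (intro hook_span_sum schur_in_hook_span)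
    fix l assume l: "l \<in> addv a p"
    then show "l \<in> parts (d + a)" using * by (auto simp: addv_def parts_def)
    have "l r \<le> Suc (p r)" using l by (auto simp: addv_def vstrip_def)
    with p(2) show "l r \<le> Suc c" by linarith
  qed
  finally show "conv (ecoeff a) (schur p) \<in> hook_span (Suc c) r (d + a)" .
qed

text \<open>Stripping off the first row (or, once no row is left to strip, the first column) with a
  Pieri rule expresses \<open>s\<^sub>p\<close> through a smaller hook span and Schur functions whose first row
  (column) is longer.\<close>

lemma schur_conv_hook_span_columns:
  assumes f: "f \<in> hook_span c r d"
  shows "p \<in> parts d' \<Longrightarrow> p 0 \<le> c' \<Longrightarrow> conv (schur p) f \<in> hook_span (c + c') r (d + d')"
proof (induction c' arbitrary: p d')
  case 0
  then have p: "part p" "psize p = d'" by (auto simp: parts_def)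
  have "p = (\<lambda>_. 0)"
    using 0(2) part_antimonoD[OF p(1), of 0] by (auto intro!: ext)
  then have "schur p = hcoeff 0" "d' = 0"
    using p(2) by (auto simp: schur_empty hcoeff_def psize_def)
  then have "conv (schur p) f = f" "d' = 0" by (auto simp: hcoeff_0_conv)
  then show ?case using f by simp
next
  case (Suc c')
  note IH_col = Suc.IH
  from Suc.prems show ?case
  \<comment> \<open>The least zero of \<open>p\<close> is the length of its first column, and it
    never exceeds \<open>d'\<close>; the inner hypothesis covers shapes with a longer first
    column.\<close>
  proof (induction "d' - (LEAST i. p i = 0)" arbitrary: p rule: less_induct)
    case less
    then have p: "part p" "psize p = d'" by (auto simp: parts_def)
    define n where "n = (LEAST i. p i = 0)"
    \<comment> \<open>Deleting the first column, of length \<open>n\<close>, gives \<open>q\<close>;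
      among the shapes in the expansion of \<open>e_n s_q\<close>, only \<open>p\<close> has row
      \<open>n\<close> empty.\<close>
    define q where "q = (\<lambda>i. p i - 1)"
    obtain N where N: "\<And>i. N \<le> i \<Longrightarrow> p i = 0" using partE[OF p(1)] by metis
    have pn: "p n = 0"
      unfolding n_def by (rule LeastI[of _ N]) (simp add: N)
    have p0: "p i = 0" if "n \<le> i" for i
      using part_antimonoD[OF p(1) that] pn by simp
    have ppos: "p i \<noteq> 0" if "i < n" for i using that not_less_Least unfolding n_def by blast
    have q: "part q"
      using part_antimonoD[OF p(1)] N by (intro partI[of q N]) (auto simp: q_def diff_le_mono)
    have "psize p = sum p {..<n}" "psize q = sum q {..<n}"
      by (rule psize_eq_sum_lessThan; use p0 in \<open>simp add: q_def\<close>)+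
    moreover have "sum p {..<n} = (\<Sum>i<n. q i + 1)"
      using ppos by (intro sum.cong) (auto simp: q_def)
    moreover have "\<dots> = sum q {..<n} + n" by (simp only: sum.distrib) simp
    ultimately have size: "d' = psize q + n" using p(2) by linarith
    have pin: "p \<in> addv n q"
      using p size by (auto simp: addv_def vstrip_def q_def)
    have rest: "conv (schur l) f \<in> hook_span (c + Suc c') r (d + d')" if l: "l \<in> addv n q - {p}" for l
    proof (rule less.hyps)
      have lp: "part l" "psize l = d'" and v: "l i \<le> Suc (q i)" for i
        using l size by (auto simp: addv_def vstrip_def)
      then show "l \<in> parts d'" by (simp add: parts_def)
      show "l 0 \<le> Suc c'" using v[of 0] less.prems(2) by (auto simp: q_def)
      have "l n \<noteq> 0"
      proof
        assume "l n = 0"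
        then have "l i \<le> p i" for i
          using v[of i] ppos[of i] part_antimonoD[OF lp(1), of n i]
          by (cases "i < n") (auto simp: q_def)
        then have "l = p" using psize_mono(2)[OF p(1) lp(1)] lp(2) p(2) by simp
        then show False using l by simp
      qed
      moreover define k where "k = (LEAST i. l i = 0)"
      moreover have ld: "l d' = 0" using part_psize_zero[OF lp(1), of d'] lp(2) by simp
      moreover have "l k = 0" unfolding k_def by (rule LeastI[of _ d']) (rule ld)
      moreover have "k \<le> d'" unfolding k_def by (rule Least_le) (rule ld)
      ultimately have "n < k" using part_antimonoD[OF lp(1), of k n] by (cases "k \<le> n") auto
      then show "d' - (LEAST i. l i = 0) < d' - (LEAST i. p i = 0)"
        using \<open>k \<le> d'\<close> unfolding n_def[symmetric] k_def[symmetric] by linarith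
    qed
    have "conv (schur p) f = (\<lambda>xs. conv (ecoeff n) (conv (schur q) f) xs
         - (\<Sum>l\<in>addv n q - {p}. conv (schur l) f xs))"
    proof
      fix xs
      have "conv (ecoeff n) (conv (schur q) f) xs = (\<Sum>l\<in>addv n q. conv (schur l) f xs)"
        by (simp add: conv_assoc[symmetric] conv_ecoeff_schur[OF q] conv_sum_left)
      then show "conv (schur p) f xs = conv (ecoeff n) (conv (schur q) f) xs
         - (\<Sum>l\<in>addv n q - {p}. conv (schur l) f xs)"
        using pin by (simp add: sum.remove[of _ p])
    qed
    also have "\<dots> \<in> hook_span (c + Suc c') r (d + d')"
    proof (intro hook_span_diff hook_span_sum rest)
      have "conv (schur q) f \<in> hook_span (c + c') r (d + psize q)"
        using less.prems(2) q by (intro IH_col) (auto simp: parts_def q_def)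
      from ecoeff_hook_span[OF this, of n]
      show "conv (ecoeff n) (conv (schur q) f) \<in> hook_span (c + Suc c') r (d + d')"
        by (simp add: size add.assoc)
    qed
    finally show ?case .
  qed
qed

text \<open>The outer induction strips the first row, which lowers the row index by one; at
  \<open>r' = 0\<close> at most \<open>c'\<close> columns remain. The other shapes of the Pieri rule
  have a longer first row, whence the inner measure \<open>d' - p 0\<close>, and no later row longer
  than in \<open>p\<close>, so the bound \<open>c'\<close> persists.\<close>

lemma schur_conv_hook_span:
  assumes f: "f \<in> hook_span c r d"
  shows "p \<in> parts d' \<Longrightarrow> p r' \<le> c' \<Longrightarrow> conv (schur p) f \<in> hook_span (c + c') (r + r') (d + d')"
proof (induction r' arbitrary: p d')
  case 0
  then show ?case using schur_conv_hook_span_columns[OF f] by simp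
next
  case (Suc r')
  note IH_row = Suc.IH
  from Suc.prems show ?case
  proof (induction "d' - p 0" arbitrary: p rule: less_induct)
    case less
    then have p: "part p" "psize p = d'" by (auto simp: parts_def)
    define q where "q = (\<lambda>i. p (Suc i))"
    obtain N where N: "\<And>i. N \<le> i \<Longrightarrow> p i = 0" using partE[OF p(1)] by metis
    have q: "part q"
      using part_antimonoD[OF p(1)] N by (intro partI[of q N]) (auto simp: q_def)
    have size: "d' = psize q + p 0" using psize_Suc_shift[OF p(1)] p(2) by (simp add: q_def)
    have pin: "p \<in> addh (p 0) q"
      using p size part_antimonoD[OF p(1)] by (auto simp: addh_def hstrip_def q_def)
    have rest: "conv (schur l) f \<in> hook_span (c + c') (r + Suc r') (d + d')"
      if l: "l \<in> addh (p 0) q - {p}" for l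
    proof (rule less.hyps)
      have lp: "part l" "psize l = d'" and h: "l (Suc i) \<le> p (Suc i)" for i
        using l size by (auto simp: addh_def hstrip_def q_def)
      then show "l \<in> parts d'" by (simp add: parts_def)
      show "l (Suc r') \<le> c'" using h[of r'] less.prems(2) by simp
      have "\<not> l 0 \<le> p 0"
      proof
        assume "l 0 \<le> p 0"
        then have "l i \<le> p i" for i using h by (cases i) auto
        then have "l = p" using psize_mono(2)[OF p(1) lp(1)] lp(2) p(2) by simp
        then show False using l by simp
      qed
      then show "d' - l 0 < d' - p 0" using le_psize[OF lp(1), of 0] lp(2) by linarith
    qed
    have "conv (schur p) f = (\<lambda>xs. conv (hcoeff (p 0)) (conv (schur q) f) xs
         - (\<Sum>l\<in>addh (p 0) q - {p}. conv (schur l) f xs))"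
    proof
      fix xs
      have "conv (hcoeff (p 0)) (conv (schur q) f) xs = (\<Sum>l\<in>addh (p 0) q. conv (schur l) f xs)"
        by (simp add: conv_assoc[symmetric] conv_hcoeff_schur[OF q] conv_sum_left)
      then show "conv (schur p) f xs = conv (hcoeff (p 0)) (conv (schur q) f) xs
         - (\<Sum>l\<in>addh (p 0) q - {p}. conv (schur l) f xs)"
        using pin by (simp add: sum.remove[of _ p])
    qed
    also have "\<dots> \<in> hook_span (c + c') (r + Suc r') (d + d')"
    proof (intro hook_span_diff hook_span_sum rest)
      have "conv (schur q) f \<in> hook_span (c + c') (r + r') (d + psize q)"
        using less.prems(2) q by (intro IH_row) (auto simp: parts_def q_def)
      from hcoeff_hook_span[OF this, of "p 0"]
      show "conv (hcoeff (p 0)) (conv (schur q) f) \<in> hook_span (c + c') (r + Suc r') (d + d')"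
        by (simp add: size add.assoc)
    qed
    finally show ?case .
  qed
qed

section \<open>Linear independence of Schur functions\<close>

text \<open>The order in which Schur coefficients at partition exponents form a unitriangular
  matrix.\<close>

definition lex_less :: "(nat \<Rightarrow> nat) \<Rightarrow> (nat \<Rightarrow> nat) \<Rightarrow> bool" where
  "lex_less p q \<longleftrightarrow> (\<exists>i. (\<forall>j<i. p j = q j) \<and> p i < q i)"

lemma asymp_lex_less: "asymp lex_less"
proof (rule asympI, rule notI)
  fix p q assume "lex_less p q" "lex_less q p"
  then obtain i k where "\<forall>j<i. p j = q j" "p i < q i" "\<forall>j<k. q j = p j" "q k < p k"
    by (auto simp: lex_less_def)
  then show False by (cases i k rule: linorder_cases) auto
qed

lemma transp_lex_less: "transp lex_less"
proof (rule transpI)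
  fix p q s assume "lex_less p q" "lex_less q s"
  then obtain i k where "\<forall>j<i. p j = q j" "p i < q i" "\<forall>j<k. q j = s j" "q k < s k"
    by (auto simp: lex_less_def)
  then show "lex_less p s" unfolding lex_less_def
    by (intro exI[of _ "min i k"]) (cases i k rule: linorder_cases; auto)
qed

text \<open>The largest letter takes \<open>p 0\<close> cells, the most that a horizontal strip in
  \<open>p\<close> can have, so what is left is exactly \<open>p\<close> without its first row.
  There is thus a single choice at every stage.\<close>

lemma schur_diagonal:
  assumes "part p" "p N = 0"
  shows "schur p (map p [0..<N]) = 1"
  using assms
proof (induction N arbitrary: p)
  case 0
  then have "p = (\<lambda>_. 0)" using part_antimonoD[OF 0(1), of 0] by (auto intro!: ext)
  then show ?case by simp
next
  case (Suc N)
  let ?q = "\<lambda>i. p (Suc i)"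
  have q: "part ?q" "hstrip ?q p"
    using Suc.prems part_antimonoD[OF Suc.prems(1)]
    by (auto intro!: part_hstrip_below[OF Suc.prems(1)] simp: hstrip_def)
  have "l = ?q" if l: "l \<in> remh (p 0) p" for l
  proof -
    have lp: "part l" "psize l = psize ?q" "\<And>i. ?q i \<le> l i"
      using l psize_Suc_shift[OF Suc.prems(1)] by (auto simp: remh_def hstrip_def)
    then show ?thesis using psize_mono(2)[OF lp(1) q(1) lp(3)] by simp
  qed
  moreover have "?q \<in> remh (p 0) p"
    using q psize_Suc_shift[OF Suc.prems(1)] by (auto simp: remh_def)
  ultimately have rem: "remh (p 0) p = {?q}" by blast
  have "map p [0..<Suc N] = p 0 # map ?q [0..<N]"
    by (simp add: upt_conv_Cons map_Suc_upt[symmetric] del: upt_Suc)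
  then show ?case using Suc.IH[OF q(1)] Suc.prems(2) rem by simp
qed

text \<open>A horizontal strip removed from \<open>q\<close> leaves at least the rows of
  \<open>q\<close> after the first, so a strip of size \<open>p 0\<close> requires
  \<open>p 0 \<le> q 0\<close>. Equality forces the remainder to be precisely those rows, and the
  comparison continues there.\<close>

lemma schur_triangular:
  assumes "part p" "part q" "schur q (map p [0..<N]) \<noteq> 0" "p N = 0"
  shows "q = p \<or> lex_less p q"
  using assms
proof (induction N arbitrary: p q)
  case 0
  then have "p = (\<lambda>_. 0)" using part_antimonoD[OF 0(1), of 0] by (auto intro!: ext)
  then show ?case using 0 by (simp split: if_splits)
next
  case (Suc N)
  let ?p = "\<lambda>i. p (Suc i)" and ?q = "\<lambda>i. q (Suc i)"
  have q: "part ?q" "hstrip ?q q" and p: "part ?p"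
    using Suc.prems part_antimonoD[OF Suc.prems(1)] part_antimonoD[OF Suc.prems(2)]
    by (auto intro!: part_hstrip_below[OF Suc.prems(1), of ?p]
        part_hstrip_below[OF Suc.prems(2), of ?q] simp: hstrip_def)
  have "map p [0..<Suc N] = p 0 # map ?p [0..<N]"
    by (simp add: upt_conv_Cons map_Suc_upt[symmetric] del: upt_Suc)
  then have "(\<Sum>l\<in>remh (p 0) q. schur l (map ?p [0..<N])) \<noteq> 0"
    using Suc.prems(3) by simp
  then obtain l where l: "l \<in> remh (p 0) q" "schur l (map ?p [0..<N]) \<noteq> 0"
    by (meson sum.neutral)
  have lq: "part l" "psize q = psize l + p 0" "\<And>i. ?q i \<le> l i"
    using l by (auto simp: remh_def hstrip_def)
  have le: "psize ?q \<le> psize l" "psize ?q = psize l \<Longrightarrow> ?q = l"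
    using psize_mono[OF lq(1) q(1) lq(3)] by auto
  have s: "psize q = q 0 + psize ?q" by (rule psize_Suc_shift[OF Suc.prems(2)])
  show ?case
  proof (cases "p 0 < q 0")
    case True
    then show ?thesis by (auto simp: lex_less_def intro: exI[of _ 0])
  next
    case False
    then have "p 0 = q 0" "?q = l" using le s lq(2) by auto
    with Suc.IH[OF p lq(1) l(2)] Suc.prems(4) have "?q = ?p \<or> lex_less ?p ?q" by simp
    then show ?thesis
    proof
      assume "?q = ?p"
      have "q = p"
      proof
        fix i show "q i = p i"
          using \<open>p 0 = q 0\<close> fun_cong[OF \<open>?q = ?p\<close>, of "i - 1"] by (cases i) auto
      qed
      then show ?thesis ..
    next
      assume "lex_less ?p ?q"
      then obtain i where i: "\<forall>j<i. ?p j = ?q j" "?p i < ?q i" by (auto simp: lex_less_def)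
      then have "\<forall>j<Suc i. p j = q j" using \<open>p 0 = q 0\<close> by (auto simp: less_Suc_eq_0_disj)
      then show ?thesis using i(2) unfolding lex_less_def by blast
    qed
  qed
qed

text \<open>Take a lexicographically maximal shape \<open>m\<close> with nonzero coefficient. At the
  exponents of \<open>m\<close>, triangularity kills all other terms and the diagonal entry is
  1.\<close>

lemma schur_linear_independent:
  assumes "\<And>xs. (\<Sum>p\<in>parts d. a p * schur p xs) = 0" "p \<in> parts d"
  shows "a p = 0"
proof (rule ccontr)
  assume "a p \<noteq> 0"
  define A where "A = {p \<in> parts d. a p \<noteq> 0}"
  have "finite A" "A \<noteq> {}" using finite_parts \<open>a p \<noteq> 0\<close> assms(2) by (auto simp: A_def)
  then obtain m where m: "m \<in> A" "\<And>x. x \<in> A \<Longrightarrow> x \<noteq> m \<Longrightarrow> \<not> lex_less m x"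
    using Finite_Set.bex_max_element[of A lex_less, OF _ asymp_on_subset[OF asymp_lex_less]
        transp_on_subset[OF transp_lex_less]] by auto
  then have pm: "part m" by (auto simp: A_def parts_def)
  obtain N where "\<And>i. N \<le> i \<Longrightarrow> m i = 0" using partE[OF pm] by metis
  then have N: "m N = 0" by simp
  have "0 = (\<Sum>p\<in>parts d. a p * schur p (map m [0..<N]))" by (simp add: assms(1))
  also have "\<dots> = (\<Sum>p\<in>{m}. a p * schur p (map m [0..<N]))"
  proof (rule sum.mono_neutral_right[OF finite_parts])
    show "{m} \<subseteq> parts d" using m by (auto simp: A_def)
    show "\<forall>i\<in>parts d - {m}. a i * schur i (map m [0..<N]) = 0"
    proof
      fix i assume i: "i \<in> parts d - {m}"
      show "a i * schur i (map m [0..<N]) = 0"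
      proof (rule ccontr)
        assume nz: "a i * schur i (map m [0..<N]) \<noteq> 0"
        then have "i \<in> A" "part i" using i by (auto simp: A_def parts_def)
        then show False using m(2)[of i] schur_triangular[OF pm, of i N] N nz i by auto
      qed
    qed
  qed
  also have "\<dots> = a m" using schur_diagonal[OF pm N] by simp
  finally show False using m by (simp add: A_def)
qed

section \<open>Tableaux\<close>

definition cells :: "(nat \<Rightarrow> nat) \<Rightarrow> (nat \<times> nat) set" where
  "cells p = {(j, i). j < p i}"

definition tableaux :: "(nat \<Rightarrow> nat) \<Rightarrow> (nat \<Rightarrow> nat) \<Rightarrow> (nat \<times> nat \<Rightarrow> nat) set" where
  "tableaux p \<alpha> = {T. (\<forall>x. x \<notin> cells p \<longrightarrow> T x = 0)
     \<and> (\<forall>j i. (Suc j, i) \<in> cells p \<longrightarrow> T (j, i) \<le> T (Suc j, i))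
     \<and> (\<forall>j i. (j, Suc i) \<in> cells p \<longrightarrow> T (j, i) < T (j, Suc i))
     \<and> (\<forall>v. card {x \<in> cells p. T x = v} = \<alpha> v)}"

lemma cells_card:
  assumes "part p"
  shows "finite (cells p)" "card (cells p) = psize p"
proof -
  obtain N where N: "psize p = sum p {..<N}" "\<And>i. N \<le> i \<Longrightarrow> p i = 0"
    using partE[OF assms] by (metis order_refl)
  have *: "cells p = (\<lambda>(i, j). (j, i)) ` (SIGMA i:{..<N}. {..<p i})"
    using N(2) by (force simp: cells_def not_le[symmetric])
  then show "finite (cells p)" by simp
  have "card (cells p) = card (SIGMA i:{..<N}. {..<p i})"
    unfolding * by (rule card_image) (auto simp: inj_on_def)
  then show "card (cells p) = psize p" using N(1) by simp
qed

lemma tableaux_bound: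
  assumes "part p" "T \<in> tableaux p \<alpha>" "\<forall>v\<ge>m. \<alpha> v = 0" "x \<in> cells p"
  shows "T x < m"
proof (rule ccontr)
  assume "\<not> T x < m"
  then have "card {y \<in> cells p. T y = T x} = 0" using assms(2,3) by (auto simp: tableaux_def)
  \<comment> \<open>Finiteness matters here: an infinite set would have cardinality 0 as
    well.\<close>
  moreover have "finite {y \<in> cells p. T y = T x}" using cells_card(1)[OF assms(1)] by simp
  ultimately show False using assms(4) by (cases x) auto
qed

text \<open>The shape occupied by the entries below \<open>m\<close>. Rows of a tableau increase
  weakly, so these entries form an initial segment and their number is the row length.\<close>

definition inner_shape :: "nat \<Rightarrow> (nat \<Rightarrow> nat) \<Rightarrow> (nat \<times> nat \<Rightarrow> nat) \<Rightarrow> nat \<Rightarrow> nat" where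
  "inner_shape m p T i = card {j. j < p i \<and> T (j, i) < m}"

definition restrict_cells :: "(nat \<Rightarrow> nat) \<Rightarrow> (nat \<times> nat \<Rightarrow> nat) \<Rightarrow> nat \<times> nat \<Rightarrow> nat" where
  "restrict_cells q T x = (if x \<in> cells q then T x else 0)"

definition extend_cells :: "nat \<Rightarrow> (nat \<Rightarrow> nat) \<Rightarrow> (nat \<Rightarrow> nat) \<Rightarrow> (nat \<times> nat \<Rightarrow> nat) \<Rightarrow> nat \<times> nat \<Rightarrow> nat" where
  "extend_cells m p q T x = (if x \<in> cells q then T x else if x \<in> cells p then m else 0)"

lemma down_closed_card:
  fixes P :: "nat \<Rightarrow> bool"
  assumes "\<And>j. Suc j < n \<Longrightarrow> P (Suc j) \<Longrightarrow> P j" "j < n"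
  shows "j < card {j. j < n \<and> P j} \<longleftrightarrow> P j"
proof -
  have down: "P i" if "i \<le> k" "k < n" "P k" for i k
    using that by (induction rule: inc_induct) (auto intro: assms(1))
  have fin: "finite {j. j < n \<and> P j}" by simp
  show ?thesis
  proof
    assume "P j"
    then have "{..j} \<subseteq> {j. j < n \<and> P j}" using down[of _ j] assms(2) by auto
    from card_mono[OF fin this] show "j < card {j. j < n \<and> P j}" by simp
  next
    assume less: "j < card {j. j < n \<and> P j}"
    show "P j"
    proof (rule ccontr)
      assume "\<not> P j"
      then have "{j. j < n \<and> P j} \<subseteq> {..<j}" using down[of j] by (auto simp: not_less[symmetric])
      from card_mono[OF _ this] less show False by simp
    qed
  qed
qed

text \<open>Strictly increasing columns make the cells of the largest letter \<open>m\<close> a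
  horizontal strip. Deleting them is one step of the recursion of \<open>schur\<close>.\<close>

lemma inner_shape:
  assumes p: "part p" and T: "T \<in> tableaux p \<alpha>" and \<alpha>: "\<forall>v\<ge>Suc m. \<alpha> v = 0"
  defines "q \<equiv> inner_shape m p T"
  shows "x \<in> cells q \<longleftrightarrow> x \<in> cells p \<and> T x < m" "hstrip q p" "q \<in> remh (\<alpha> m) p"
    "restrict_cells q T \<in> tableaux q (\<alpha>(m := 0))"
proof -
  have T0: "\<And>x. x \<notin> cells p \<Longrightarrow> T x = 0"
    and Tr: "\<And>j i. (Suc j, i) \<in> cells p \<Longrightarrow> T (j, i) \<le> T (Suc j, i)"
    and Tc: "\<And>j i. (j, Suc i) \<in> cells p \<Longrightarrow> T (j, i) < T (j, Suc i)"
    and Tv: "\<And>v. card {x \<in> cells p. T x = v} = \<alpha> v"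
    using T by (auto simp: tableaux_def)
  have Tm: "T x < Suc m" if "x \<in> cells p" for x using tableaux_bound[OF p T \<alpha> that] .
  have q_le: "q i \<le> p i" for i
  proof -
    have "card {j. j < p i \<and> T (j, i) < m} \<le> card {..<p i}" by (rule card_mono) auto
    then show ?thesis by (simp add: q_def inner_shape_def)
  qed
  have q_iff: "j < q i \<longleftrightarrow> T (j, i) < m" if "j < p i" for j i
    unfolding q_def inner_shape_def
    by (rule down_closed_card) (use that Tr in \<open>auto simp: cells_def intro: le_less_trans\<close>)
  show x: "x \<in> cells q \<longleftrightarrow> x \<in> cells p \<and> T x < m" for x
  proof (cases x)
    case (Pair j i)
    then show ?thesis using q_iff[of j i] q_le[of i] by (auto simp: cells_def)
  qed
  show hs: "hstrip q p"
    unfolding hstrip_def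
  proof (intro allI conjI q_le)
    fix i
    \<comment> \<open>Otherwise the cell \<open>(q i, Suc i)\<close> has an entry at most
      \<open>m\<close>, so \<open>(q i, i)\<close> has an entry below \<open>m\<close> although it
      is the first cell of its row outside \<open>q\<close>.\<close>
    show "p (Suc i) \<le> q i"
    proof (rule ccontr)
      assume "\<not> p (Suc i) \<le> q i"
      then have c: "(q i, Suc i) \<in> cells p" by (simp add: cells_def)
      with part_antimonoD[OF p, of i "Suc i"] have "q i < p i" by (simp add: cells_def)
      moreover have "T (q i, i) < m" using Tc[OF c] Tm[OF c] by linarith
      ultimately show False using q_iff by blast
    qed
  qed
  have pq: "part q" by (rule part_hstrip_below[OF p hs])
  have sub: "cells q \<subseteq> cells p" using x by auto
  have "{x \<in> cells p. T x = m} = cells p - cells q" using x Tm by (force simp: less_Suc_eq)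
  then have "\<alpha> m = psize p - psize q"
    using Tv[of m] card_Diff_subset[OF cells_card(1)[OF pq] sub] cells_card(2)[OF p] cells_card(2)[OF pq]
    by simp
  then show "q \<in> remh (\<alpha> m) p"
    using psize_mono(1)[OF p pq q_le] hs pq by (simp add: remh_def)
  have "card {x \<in> cells q. restrict_cells q T x = v} = (\<alpha>(m := 0)) v" for v
  proof (cases "v < m")
    case True
    then have "{x \<in> cells q. restrict_cells q T x = v} = {x \<in> cells p. T x = v}"
      using x by (auto simp: restrict_cells_def)
    then show ?thesis using Tv[of v] True by simp
  next
    case False
    then have "{x \<in> cells q. restrict_cells q T x = v} = {}"
      using x by (auto simp: restrict_cells_def)
    moreover have "(\<alpha>(m := 0)) v = 0" using False \<alpha> by (cases "v = m") auto
    ultimately show ?thesis by (simp only: card.empty)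
  qed
  moreover have down: "(j, i) \<in> cells q" if "(Suc j, i) \<in> cells q \<or> (j, Suc i) \<in> cells q" for j i
    using that part_antimonoD[OF pq, of i "Suc i"] by (auto simp: cells_def)
  have "restrict_cells q T (j, i) \<le> restrict_cells q T (Suc j, i)" if "(Suc j, i) \<in> cells q" for j i
    using that down[of j i] Tr[of j i] sub by (auto simp: restrict_cells_def)
  moreover have "restrict_cells q T (j, i) < restrict_cells q T (j, Suc i)" if "(j, Suc i) \<in> cells q" for j i
    using that down[of j i] Tc[of j i] sub by (auto simp: restrict_cells_def)
  moreover have "restrict_cells q T x = 0" if "x \<notin> cells q" for x
    using that by (simp add: restrict_cells_def)
  ultimately show "restrict_cells q T \<in> tableaux q (\<alpha>(m := 0))"
    unfolding tableaux_def by blast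
qed

text \<open>Filling the strip with \<open>m\<close> respects the columns, since a cell of
  \<open>p\<close> in row \<open>i + 1\<close> has its neighbour in row \<open>i\<close> inside
  \<open>q\<close>, where entries are below \<open>m\<close>.\<close>

lemma extend_cells:
  assumes p: "part p" and q: "q \<in> remh (\<alpha> m) p" and T: "T \<in> tableaux q (\<alpha>(m := 0))"
    and \<alpha>: "\<forall>v\<ge>Suc m. \<alpha> v = 0"
  shows "extend_cells m p q T \<in> tableaux p \<alpha>" "inner_shape m p (extend_cells m p q T) = q"
    "restrict_cells q (extend_cells m p q T) = T"
proof -
  have T0: "\<And>x. x \<notin> cells q \<Longrightarrow> T x = 0"
    and Tr: "\<And>j i. (Suc j, i) \<in> cells q \<Longrightarrow> T (j, i) \<le> T (Suc j, i)"
    and Tc: "\<And>j i. (j, Suc i) \<in> cells q \<Longrightarrow> T (j, i) < T (j, Suc i)"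
    and Tv: "\<And>v. card {x \<in> cells q. T x = v} = (\<alpha>(m := 0)) v"
    using T by (auto simp: tableaux_def)
  have pq: "part q" and hs: "hstrip q p" and size: "psize p = psize q + \<alpha> m"
    using q by (auto simp: remh_def)
  have "\<forall>v\<ge>m. (\<alpha>(m := 0)) v = 0" using \<alpha> by (auto simp: le_Suc_eq dest: le_neq_implies_less)
  then have Tm: "T x < m" if "x \<in> cells q" for x using tableaux_bound[OF pq T _ that] by blast
  have sub: "cells q \<subseteq> cells p" using hs by (auto simp: cells_def hstrip_def intro: less_le_trans)
  let ?E = "extend_cells m p q T"
  have "card {x \<in> cells p. ?E x = v} = \<alpha> v" for v
  proof (cases "v = m")
    case True
    then have "{x \<in> cells p. ?E x = v} = cells p - cells q"
      using Tm sub by (force simp: extend_cells_def)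
    then show ?thesis
      using card_Diff_subset[OF cells_card(1)[OF pq] sub] cells_card(2)[OF p] cells_card(2)[OF pq]
        size True by simp
  next
    case False
    then have "{x \<in> cells p. ?E x = v} = {x \<in> cells q. T x = v}"
      using sub by (auto simp: extend_cells_def)
    then show ?thesis using Tv[of v] False by simp
  qed
  moreover have "?E x = 0" if "x \<notin> cells p" for x
    using that sub by (auto simp: extend_cells_def)
  moreover have "?E (j, i) \<le> ?E (Suc j, i)" if "(Suc j, i) \<in> cells p" for j i
  proof (cases "(Suc j, i) \<in> cells q")
    case True
    then have "(j, i) \<in> cells q" by (simp add: cells_def)
    with True show ?thesis using Tr by (simp add: extend_cells_def)
  next
    case False
    with that have "?E (Suc j, i) = m" by (simp add: extend_cells_def)
    then show ?thesis using Tm by (auto simp: extend_cells_def intro: less_imp_le)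
  qed
  moreover have "?E (j, i) < ?E (j, Suc i)" if "(j, Suc i) \<in> cells p" for j i
  proof -
    have c: "(j, i) \<in> cells q" using hs that
      by (auto simp: cells_def hstrip_def intro: less_le_trans)
    then show ?thesis using Tc[of j i] Tm[OF c] that by (simp add: extend_cells_def)
  qed
  ultimately show "?E \<in> tableaux p \<alpha>" unfolding tableaux_def by blast
  show "inner_shape m p ?E = q"
  proof
    fix i
    have "{j. j < p i \<and> ?E (j, i) < m} = {..<q i}"
      using Tm hs by (auto simp: extend_cells_def cells_def hstrip_def split: if_splits intro: less_le_trans)
    then show "inner_shape m p ?E i = q i" by (simp add: inner_shape_def)
  qed
  show "restrict_cells q ?E = T"
    using T0 by (auto simp: restrict_cells_def extend_cells_def)
qed

lemma extend_restrict:
  assumes p: "part p" and T: "T \<in> tableaux p \<alpha>" and \<alpha>: "\<forall>v\<ge>Suc m. \<alpha> v = 0"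
  shows "extend_cells m p (inner_shape m p T) (restrict_cells (inner_shape m p T) T) = T"
proof
  fix x
  have T0: "x \<notin> cells p \<Longrightarrow> T x = 0" using T by (cases x) (simp add: tableaux_def)
  show "extend_cells m p (inner_shape m p T) (restrict_cells (inner_shape m p T) T) x = T x"
    using inner_shape(1)[OF p T \<alpha>, of x] tableaux_bound[OF p T \<alpha>, of x] T0
    by (auto simp: extend_cells_def restrict_cells_def)
qed

lemma rev_map_upt_Suc: "rev (map f [0..<Suc m]) = f m # rev (map f [0..<m])"
  by simp

text \<open>Splitting off the largest letter is a bijection that matches the recursion of
  \<open>schur\<close>; \<open>rev\<close> puts the exponent of that letter at the head. Finiteness
  is carried through the induction so that the cardinalities of the fibres can be added.\<close>

lemma tableaux_card:
  assumes "part p" "\<forall>v\<ge>m. \<alpha> v = 0"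
  shows "finite (tableaux p \<alpha>) \<and> int (card (tableaux p \<alpha>)) = schur p (rev (map \<alpha> [0..<m]))"
  using assms
proof (induction m arbitrary: p \<alpha>)
  case 0
  show ?case
  proof (cases "p = (\<lambda>_. 0)")
    case True
    then have "tableaux p \<alpha> = {\<lambda>_. 0}" using 0(2) by (auto simp: tableaux_def cells_def)
    then show ?thesis using True by simp
  next
    case False
    then obtain i where "(0, i) \<in> cells p" by (auto simp: cells_def)
    then have "tableaux p \<alpha> = {}" using tableaux_bound[OF 0(1) _ 0(2)] by blast
    then show ?thesis using False by simp
  qed
next
  case (Suc m)
  let ?\<beta> = "\<alpha>(m := 0)"
  have \<beta>: "\<forall>v\<ge>m. ?\<beta> v = 0" using Suc.prems(2) by auto
  have L: "map ?\<beta> [0..<m] = map \<alpha> [0..<m]" by simp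
  have IH: "finite (tableaux q ?\<beta>) \<and> int (card (tableaux q ?\<beta>)) = schur q (rev (map \<alpha> [0..<m]))"
    if "q \<in> remh (\<alpha> m) p" for q
  proof -
    have "part q" using that by (simp add: remh_def)
    from Suc.IH[OF this \<beta>] show ?thesis unfolding L .
  qed
  note p = Suc.prems(1) and \<alpha> = Suc.prems(2)
  have bij: "bij_betw (\<lambda>T. (inner_shape m p T, restrict_cells (inner_shape m p T) T))
      (tableaux p \<alpha>) (SIGMA q:remh (\<alpha> m) p. tableaux q ?\<beta>)"
    by (rule bij_betw_byWitness[where f' = "\<lambda>(q, T). extend_cells m p q T"])
      (use inner_shape(3,4)[OF p _ \<alpha>] extend_cells[OF p _ _ \<alpha>] extend_restrict[OF p _ \<alpha>] in auto)
  have "finite (SIGMA q:remh (\<alpha> m) p. tableaux q ?\<beta>)" using IH by auto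
  then have "finite (tableaux p \<alpha>)" using bij_betw_finite[OF bij] by simp
  moreover have "int (card (tableaux p \<alpha>)) = schur p (rev (map \<alpha> [0..<Suc m]))"
    unfolding rev_map_upt_Suc bij_betw_same_card[OF bij] using IH by (simp add: card_SigmaI)
  ultimately show ?case by blast
qed

section \<open>Partitions as lists and as functions\<close>

definition row :: "nat list \<Rightarrow> nat \<Rightarrow> nat" where
  "row la i = (if i < length la then la ! i else 0)"

lemma diagram_eq_cells: "diagram la = cells (row la)"
  by (auto simp: diagram_def cells_def row_def)

lemma part_row:
  assumes "is_partition la"
  shows "part (row la)"
proof (rule partI[of _ "length la"])
  show "row la (Suc i) \<le> row la i" for i
    using assms by (auto simp: row_def is_partition_def sorted_wrt_iff_nth_less)
qed (simp add: row_def)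

lemma psize_row: "psize (row la) = sum_list la"
  using psize_eq_sum_lessThan[of "length la" "row la"]
  by (simp add: row_def sum_list_sum_nth atLeast0LessThan)

text \<open>The entries of a partition list are positive, so the least zero of \<open>row nu\<close>
  is the length of \<open>nu\<close>, and cutting there recovers the list.\<close>

lemma row_bij: "bij_betw row {nu. is_partition nu \<and> sum_list nu = d} (parts d)"
proof (rule bij_betw_byWitness[where f' = "\<lambda>p. map p [0..<LEAST i. p i = 0]"])
  show "\<forall>nu\<in>{nu. is_partition nu \<and> sum_list nu = d}. map (row nu) [0..<LEAST i. row nu i = 0] = nu"
  proof
    fix nu assume "nu \<in> {nu. is_partition nu \<and> sum_list nu = d}"
    then have pos: "\<And>i. i < length nu \<Longrightarrow> row nu i \<noteq> 0" by (auto simp: row_def is_partition_def)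
    have "(LEAST i. row nu i = 0) = length nu"
    proof (rule Least_equality)
      show "length nu \<le> i" if "row nu i = 0" for i
        using pos[of i] that by (cases "i < length nu") auto
    qed (simp add: row_def)
    then show "map (row nu) [0..<LEAST i. row nu i = 0] = nu"
      by (auto simp: row_def intro: nth_equalityI)
  qed
  have P: "row (map p [0..<LEAST i. p i = 0]) = p \<and> is_partition (map p [0..<LEAST i. p i = 0])"
    if p: "part p" for p
  proof -
    define n where "n = (LEAST i. p i = 0)"
    obtain N where "\<And>i. N \<le> i \<Longrightarrow> p i = 0" using partE[OF p] by metis
    then have "p n = 0" unfolding n_def by (rule LeastI[of _ N]) simp
    then have "p i = 0" if "n \<le> i" for i using part_antimonoD[OF p that] by simp
    then have "row (map p [0..<n]) = p" by (auto simp: row_def)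
    moreover have "p i \<noteq> 0" if "i < n" for i using that not_less_Least unfolding n_def by blast
    then have "is_partition (map p [0..<n])"
      using part_antimonoD[OF p] by (auto simp: is_partition_def sorted_wrt_iff_nth_less)
    ultimately show ?thesis by (simp add: n_def)
  qed
  then show "\<forall>p\<in>parts d. row (map p [0..<LEAST i. p i = 0]) = p" by (auto simp: parts_def)
  show "row ` {nu. is_partition nu \<and> sum_list nu = d} \<subseteq> parts d"
    using part_row psize_row by (auto simp: parts_def)
  show "(\<lambda>p. map p [0..<LEAST i. p i = 0]) ` parts d \<subseteq> {nu. is_partition nu \<and> sum_list nu = d}"
  proof (rule image_subsetI)
    fix p assume "p \<in> parts d"
    then show "map p [0..<LEAST i. p i = 0] \<in> {nu. is_partition nu \<and> sum_list nu = d}"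
      using P[of p] psize_row[of "map p [0..<LEAST i. p i = 0]"] by (simp add: parts_def)
  qed
qed

lemma tableaux_row: "tableaux (row la) \<alpha> = {T. ssyt la T \<and> content la T = \<alpha>}"
  by (auto simp: tableaux_def ssyt_def diagram_eq_cells content_def fun_eq_iff)

lemma kostka_eq_schur:
  assumes "is_partition la" "\<forall>v\<ge>m. \<alpha> v = 0"
  shows "int (kostka la \<alpha>) = schur (row la) (rev (map \<alpha> [0..<m]))"
  using tableaux_card[OF part_row[OF assms(1)] assms(2)] by (simp add: kostka_def tableaux_row)

section \<open>Products as sums over exponent vectors\<close>

lemma finite_le_fun:
  fixes \<alpha> :: "nat \<Rightarrow> nat"
  assumes "\<forall>v\<ge>m. \<alpha> v = 0"
  shows "finite {\<beta>. \<forall>v. \<beta> v \<le> \<alpha> v}"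
proof (rule finite_subset)
  show "{\<beta>. \<forall>v. \<beta> v \<le> \<alpha> v} \<subseteq>
    {f. \<forall>x. (x \<in> {..<m} \<longrightarrow> f x \<in> {..sum \<alpha> {..<m}}) \<and> (x \<notin> {..<m} \<longrightarrow> f x = 0)}"
  proof (intro subsetI CollectI allI conjI impI)
    fix \<beta> x assume \<beta>: "\<beta> \<in> {\<beta>. \<forall>v. \<beta> v \<le> \<alpha> v}"
    {
      assume "x \<in> {..<m}"
      then have "\<alpha> x \<le> sum \<alpha> {..<m}" by (intro member_le_sum) auto
      then show "\<beta> x \<in> {..sum \<alpha> {..<m}}" using \<beta> by (auto intro: le_trans)
    }
    assume "x \<notin> {..<m}"
    then have "\<alpha> x = 0" using assms by simp
    then show "\<beta> x = 0" using \<beta> by (metis le_zero_eq mem_Collect_eq)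
  qed
  show "finite {f. \<forall>x. (x \<in> {..<m} \<longrightarrow> f x \<in> {..sum \<alpha> {..<m}}) \<and> (x \<notin> {..<m} \<longrightarrow> f x = 0)}"
    by (rule finite_set_of_finite_funs) auto
qed

text \<open>The letter-by-letter choices in \<open>conv\<close> are collected into one vector
  \<open>\<beta>\<close>, the share at the head becoming \<open>\<beta> m\<close> in the induction
  step. As \<open>\<alpha>\<close> vanishes from the bound on, so does \<open>\<beta>\<close>, and
  the list determines it.\<close>

lemma conv_eq_sum:
  assumes "\<forall>v\<ge>m. \<alpha> v = 0"
  shows "conv f g (rev (map \<alpha> [0..<m])) =
    (\<Sum>\<beta> | \<forall>v. \<beta> v \<le> \<alpha> v. f (rev (map \<beta> [0..<m])) * g (rev (map (\<lambda>v. \<alpha> v - \<beta> v) [0..<m])))"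
  using assms
proof (induction m arbitrary: \<alpha> f g)
  case 0
  then have "{\<beta>. \<forall>v. \<beta> v \<le> \<alpha> v} = {\<lambda>_. 0}" by auto
  then show ?case by simp
next
  case (Suc m)
  let ?\<alpha>' = "\<alpha>(m := 0)"
  let ?h = "\<lambda>i \<beta>. f (i # rev (map \<beta> [0..<m])) * g ((\<alpha> m - i) # rev (map (\<lambda>v. \<alpha> v - \<beta> v) [0..<m]))"
  have \<alpha>': "\<forall>v\<ge>m. ?\<alpha>' v = 0" using Suc.prems by auto
  have L: "map ?\<alpha>' [0..<m] = map \<alpha> [0..<m]"
    "map (\<lambda>v. ?\<alpha>' v - \<beta> v) [0..<m] = map (\<lambda>v. \<alpha> v - \<beta> v) [0..<m]" for \<beta> by simp_all
  have fin: "finite {\<beta>. \<forall>v. \<beta> v \<le> ?\<alpha>' v}" by (rule finite_le_fun[OF \<alpha>'])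
  have "conv f g (rev (map \<alpha> [0..<Suc m])) = (\<Sum>i\<le>\<alpha> m. \<Sum>\<beta> | \<forall>v. \<beta> v \<le> ?\<alpha>' v. ?h i \<beta>)"
    unfolding rev_map_upt_Suc conv.simps using Suc.IH[OF \<alpha>'] unfolding L by simp
  also have "\<dots> = (\<Sum>(i, \<beta>)\<in>{..\<alpha> m} \<times> {\<beta>. \<forall>v. \<beta> v \<le> ?\<alpha>' v}. ?h i \<beta>)"
    using fin by (intro sum.cartesian_product)
  also have "\<dots> = (\<Sum>\<beta> | \<forall>v. \<beta> v \<le> \<alpha> v. ?h (\<beta> m) (\<beta>(m := 0)))"
  proof (rule sum.reindex_bij_witness[where i = "\<lambda>\<beta>. (\<beta> m, \<beta>(m := 0))" and j = "\<lambda>(i, \<beta>). \<beta>(m := i)"],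
      goal_cases)
    case (1 a)
    then have "snd a m \<le> 0" by (auto dest: spec[of _ m])
    then show ?case by (cases a) (auto simp: fun_upd_idem_iff)
  next
    case (2 a)
    then show ?case by (auto split: if_splits)
  next
    case (5 a)
    then obtain i b where a: "a = (i, b)" "b m = 0" by (auto dest: spec[of _ m])
    then have "(b(m := i)) m = i" "(b(m := i))(m := 0) = b" by (simp_all add: fun_upd_idem_iff)
    then show ?case by (simp only: a prod.case)
  qed auto
  also have "\<dots> = (\<Sum>\<beta> | \<forall>v. \<beta> v \<le> \<alpha> v. f (rev (map \<beta> [0..<Suc m])) *
      g (rev (map (\<lambda>v. \<alpha> v - \<beta> v) [0..<Suc m])))"
  proof (rule sum.cong[OF refl])
    fix \<beta>
    have "map (\<beta>(m := 0)) [0..<m] = map \<beta> [0..<m]"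
      "map (\<lambda>v. \<alpha> v - (\<beta>(m := 0)) v) [0..<m] = map (\<lambda>v. \<alpha> v - \<beta> v) [0..<m]" by simp_all
    then show "?h (\<beta> m) (\<beta>(m := 0)) = f (rev (map \<beta> [0..<Suc m])) *
      g (rev (map (\<lambda>v. \<alpha> v - \<beta> v) [0..<Suc m]))" by (simp only: rev_map_upt_Suc)
  qed
  finally show ?case .
qed

section \<open>Products of Schur functions and Littlewood--Richardson coefficients\<close>

definition tableau_tuples :: "nat list list \<Rightarrow> (nat \<Rightarrow> nat) \<Rightarrow> (nat \<Rightarrow> nat \<times> nat \<Rightarrow> nat) set" where
  "tableau_tuples mus alpha = {Ts. (\<forall>k < length mus. ssyt (mus ! k) (Ts k))
      \<and> (\<forall>k \<ge> length mus. Ts k = (\<lambda>_. 0))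
      \<and> (\<forall>v. (\<Sum>k < length mus. content (mus ! k) (Ts k) v) = alpha v)}"

text \<open>The content of the first tableau is recorded separately, although the tableau determines
  it, to expose the summation index \<open>\<beta>\<close> of \<open>conv_eq_sum\<close>.\<close>

lemma tableau_tuples_Cons_bij:
  "bij_betw (\<lambda>Ts. (content mu (Ts 0), Ts 0, \<lambda>k. Ts (Suc k))) (tableau_tuples (mu # mus) \<alpha>)
    (SIGMA \<beta>:{\<beta>. \<forall>v. \<beta> v \<le> \<alpha> v}. tableaux (row mu) \<beta> \<times> tableau_tuples mus (\<lambda>v. \<alpha> v - \<beta> v))"
proof (rule bij_betw_byWitness[where f' = "\<lambda>(\<beta>, T, Us). case_nat T Us"])
  show "\<forall>Ts\<in>tableau_tuples (mu # mus) \<alpha>.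
      (\<lambda>(\<beta>, T, Us). case_nat T Us) (content mu (Ts 0), Ts 0, \<lambda>k. Ts (Suc k)) = Ts"
    by (auto simp: fun_eq_iff split: nat.split)
  show "\<forall>a\<in>(SIGMA \<beta>:{\<beta>. \<forall>v. \<beta> v \<le> \<alpha> v}. tableaux (row mu) \<beta> \<times> tableau_tuples mus (\<lambda>v. \<alpha> v - \<beta> v)).
      (\<lambda>Ts. (content mu (Ts 0), Ts 0, \<lambda>k. Ts (Suc k))) ((\<lambda>(\<beta>, T, Us). case_nat T Us) a) = a"
    by (simp add: tableaux_row case_prod_unfold)
  show "(\<lambda>Ts. (content mu (Ts 0), Ts 0, \<lambda>k. Ts (Suc k))) ` tableau_tuples (mu # mus) \<alpha> \<subseteq>
    (SIGMA \<beta>:{\<beta>. \<forall>v. \<beta> v \<le> \<alpha> v}. tableaux (row mu) \<beta> \<times> tableau_tuples mus (\<lambda>v. \<alpha> v - \<beta> v))"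
  proof (rule image_subsetI)
    fix Ts assume Ts: "Ts \<in> tableau_tuples (mu # mus) \<alpha>"
    then have "ssyt mu (Ts 0)" "\<forall>k<length mus. ssyt (mus ! k) (Ts (Suc k))"
      "\<forall>k\<ge>length mus. Ts (Suc k) = (\<lambda>_. 0)"
      by (force simp: tableau_tuples_def)+
    moreover have eq: "content mu (Ts 0) v + (\<Sum>k < length mus. content (mus ! k) (Ts (Suc k)) v) = \<alpha> v" for v
      using Ts by (simp add: tableau_tuples_def sum.lessThan_Suc_shift del: sum.lessThan_Suc)
    have "content mu (Ts 0) v \<le> \<alpha> v"
      "(\<Sum>k < length mus. content (mus ! k) (Ts (Suc k)) v) = \<alpha> v - content mu (Ts 0) v" for v
      using eq[of v] by linarith+
    ultimately show "(content mu (Ts 0), Ts 0, \<lambda>k. Ts (Suc k)) \<in>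
      (SIGMA \<beta>:{\<beta>. \<forall>v. \<beta> v \<le> \<alpha> v}. tableaux (row mu) \<beta> \<times> tableau_tuples mus (\<lambda>v. \<alpha> v - \<beta> v))"
      by (simp add: tableaux_row tableau_tuples_def)
  qed
  show "(\<lambda>(\<beta>, T, Us). case_nat T Us) ` (SIGMA \<beta>:{\<beta>. \<forall>v. \<beta> v \<le> \<alpha> v}.
     tableaux (row mu) \<beta> \<times> tableau_tuples mus (\<lambda>v. \<alpha> v - \<beta> v)) \<subseteq> tableau_tuples (mu # mus) \<alpha>"
  proof (rule image_subsetI, clarify)
    fix \<beta> T Us
    assume le: "\<forall>v. \<beta> v \<le> \<alpha> v" and T: "T \<in> tableaux (row mu) \<beta>"
      and Us: "Us \<in> tableau_tuples mus (\<lambda>v. \<alpha> v - \<beta> v)"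
    have T': "ssyt mu T" "content mu T = \<beta>" using T by (simp_all add: tableaux_row)
    have "ssyt ((mu # mus) ! k) (case_nat T Us k)" if "k < length (mu # mus)" for k
      using T' Us that by (cases k) (auto simp: tableau_tuples_def)
    moreover have "case_nat T Us k = (\<lambda>_. 0)" if "k \<ge> length (mu # mus)" for k
      using Us that by (cases k) (auto simp: tableau_tuples_def)
    moreover have "(\<Sum>k < length (mu # mus). content ((mu # mus) ! k) (case_nat T Us k) v) = \<alpha> v" for v
    proof -
      have "(\<Sum>k < length mus. content (mus ! k) (Us k) v) = \<alpha> v - \<beta> v"
        using Us by (simp add: tableau_tuples_def)
      then show ?thesis using le T' by (simp add: sum.lessThan_Suc_shift del: sum.lessThan_Suc)
    qed
    ultimately show "case_nat T Us \<in> tableau_tuples (mu # mus) \<alpha>"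
      unfolding tableau_tuples_def by blast
  qed
qed

text \<open>The empty product is \<open>hcoeff 0\<close>, the constant series 1.\<close>

definition schur_prod :: "nat list list \<Rightarrow> nat list \<Rightarrow> int" where
  "schur_prod mus = foldr (\<lambda>mu. conv (schur (row mu))) mus (hcoeff 0)"

lemma tableau_tuples_card:
  assumes "\<forall>mu\<in>set mus. is_partition mu" "\<forall>v\<ge>m. \<alpha> v = 0"
  shows "finite (tableau_tuples mus \<alpha>) \<and>
    int (card (tableau_tuples mus \<alpha>)) = schur_prod mus (rev (map \<alpha> [0..<m]))"
  using assms
proof (induction mus arbitrary: \<alpha>)
  case Nil
  have "tableau_tuples [] \<alpha> = (if \<forall>v. \<alpha> v = 0 then {\<lambda>_ _. 0} else {})"
    by (auto simp: tableau_tuples_def)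
  moreover have "(\<forall>v. \<alpha> v = 0) \<longleftrightarrow> sum_list (rev (map \<alpha> [0..<m])) = 0"
    using Nil.prems(2) by (auto simp: not_le[symmetric])
  ultimately show ?case by (simp add: schur_prod_def hcoeff_def)
next
  case (Cons mu mus)
  let ?S = "SIGMA \<beta>:{\<beta>. \<forall>v. \<beta> v \<le> \<alpha> v}. tableaux (row mu) \<beta> \<times> tableau_tuples mus (\<lambda>v. \<alpha> v - \<beta> v)"
  have fin: "finite {\<beta>. \<forall>v. \<beta> v \<le> \<alpha> v}" by (rule finite_le_fun[OF Cons.prems(2)])
  have IH: "finite (tableau_tuples mus (\<lambda>v. \<alpha> v - \<beta> v))"
    "int (card (tableau_tuples mus (\<lambda>v. \<alpha> v - \<beta> v))) =
      schur_prod mus (rev (map (\<lambda>v. \<alpha> v - \<beta> v) [0..<m]))" for \<beta>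
    using Cons.IH[of "\<lambda>v. \<alpha> v - \<beta> v"] Cons.prems by auto
  have K: "finite (tableaux (row mu) \<beta>)"
    "int (card (tableaux (row mu) \<beta>)) = schur (row mu) (rev (map \<beta> [0..<m]))"
    if "\<forall>v. \<beta> v \<le> \<alpha> v" for \<beta>
  proof -
    have "\<forall>v\<ge>m. \<beta> v = 0" using that Cons.prems(2) by (metis le_zero_eq)
    from tableaux_card[OF part_row this, of mu] Cons.prems(1)
    show "finite (tableaux (row mu) \<beta>)"
    "int (card (tableaux (row mu) \<beta>)) = schur (row mu) (rev (map \<beta> [0..<m]))" by auto
  qed
  have "finite ?S" using fin IH(1) K(1) by auto
  then have "finite (tableau_tuples (mu # mus) \<alpha>)"
    using bij_betw_finite[OF tableau_tuples_Cons_bij] by blast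
  moreover have "int (card ?S) = conv (schur (row mu)) (schur_prod mus) (rev (map \<alpha> [0..<m]))"
    unfolding conv_eq_sum[OF Cons.prems(2)]
    using fin IH K by (subst card_SigmaI) (auto simp: card_cartesian_product)
  ultimately show ?case
    using bij_betw_same_card[OF tableau_tuples_Cons_bij, of mu mus \<alpha>] by (simp add: schur_prod_def)
qed

text \<open>A corner \<open>(c, r)\<close> of \<open>mu\<close> lies outside the diagram, that is
  \<open>row mu r \<le> c\<close>, so each factor adds its corner to the two bounds. The empty
  product is the Schur function of the empty partition, with both bounds 0.\<close>

lemma schur_prod_hook_span:
  assumes "length ps = length mus" "\<forall>k < length mus. is_partition (mus ! k)"
    "\<forall>k < length mus. ps ! k \<in> OC (mus ! k)"
  shows "schur_prod mus \<in> hook_span (sum_list (map fst ps)) (sum_list (map snd ps))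
    (sum_list (map sum_list mus))"
  using assms
proof (induction ps mus rule: list_induct2)
  case Nil
  have "hcoeff 0 = schur (\<lambda>_. 0)" by (auto simp: schur_empty hcoeff_def)
  moreover have "(\<lambda>_. 0) \<in> parts 0" by (auto simp: parts_def part_def psize_def antimono_def)
  ultimately show ?case by (simp add: schur_prod_def schur_in_hook_span)
next
  case (Cons x ps mu mus)
  have "is_partition mu" "x \<in> OC mu" using Cons.prems by force+
  then have "row mu \<in> parts (sum_list mu)" "row mu (snd x) \<le> fst x"
    using part_row psize_row by (auto simp: parts_def OC_def diagram_eq_cells cells_def not_less)
  moreover have "schur_prod mus \<in> hook_span (sum_list (map fst ps)) (sum_list (map snd ps))
    (sum_list (map sum_list mus))"
    using Cons.prems by (intro Cons.IH) force+
  ultimately show ?case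
    using schur_conv_hook_span[of "schur_prod mus"] by (force simp: schur_prod_def ac_simps)
qed

text \<open>The hook span supplies coefficients \<open>c0\<close> with the property that defines
  \<open>LR_coeff\<close>. Linear independence makes them the only ones, so the definite description
  denotes \<open>c0\<close>, which vanishes wherever the bound fails.\<close>

lemma LR_coeff_nonzero_row_le:
  assumes "length ps = length mus" "\<forall>k < length mus. is_partition (mus ! k)"
    "\<forall>k < length mus. ps ! k \<in> OC (mus ! k)" "LR_coeff la mus \<noteq> 0"
  shows "row la (sum_list (map snd ps)) \<le> sum_list (map fst ps)"
proof -
  define C R d where "C = sum_list (map fst ps)" and "R = sum_list (map snd ps)"
    and "d = sum_list (map sum_list mus)"
  define D where "D = {nu. is_partition nu \<and> sum_list nu = d}"
  obtain a where a: "schur_prod mus = (\<lambda>xs. \<Sum>p | p \<in> parts d \<and> p R \<le> C. a p * schur p xs)"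
    using schur_prod_hook_span[OF assms(1-3)] by (auto simp: hook_span_def C_def R_def d_def)
  define is_coeff where "is_coeff c \<longleftrightarrow> (\<forall>nu. c nu \<noteq> 0 \<longrightarrow> is_partition nu \<and> sum_list nu = d)
       \<and> (\<forall>alpha. finite {v. alpha v \<noteq> 0} \<longrightarrow>
            int (prod_coeff mus alpha) = (\<Sum>nu\<in>D. c nu * int (kostka nu alpha)))"
    for c :: "nat list \<Rightarrow> int"
  have bij: "bij_betw row D (parts d)" unfolding D_def by (rule row_bij)
  have support: "\<exists>m. \<forall>v\<ge>m. alpha v = 0" if "finite {v. alpha v \<noteq> 0}" for alpha :: "nat \<Rightarrow> nat"
    using that unfolding finite_nat_set_iff_bounded by (auto simp: not_less[symmetric])
  have kostka: "int (kostka nu alpha) = schur (row nu) (rev (map alpha [0..<m]))"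
    if "nu \<in> D" "\<forall>v\<ge>m. alpha v = 0" for nu alpha m
    using that kostka_eq_schur by (auto simp: D_def)
  have prod: "int (prod_coeff mus alpha) = schur_prod mus (rev (map alpha [0..<m]))"
    if "\<forall>v\<ge>m. alpha v = 0" for alpha m
    using tableau_tuples_card[OF _ that, of mus] assms(2)
    by (simp add: prod_coeff_def tableau_tuples_def all_set_conv_all_nth)
  define c0 where "c0 nu = (if nu \<in> D \<and> row nu R \<le> C then a (row nu) else 0)" for nu
  have c0: "is_coeff c0"
    unfolding is_coeff_def
  proof (intro conjI allI impI)
    fix alpha :: "nat \<Rightarrow> nat" assume "finite {v. alpha v \<noteq> 0}"
    then obtain m where m: "\<forall>v\<ge>m. alpha v = 0" using support by blast
    let ?L = "rev (map alpha [0..<m])"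
    have "int (prod_coeff mus alpha) = (\<Sum>p\<in>parts d. if p R \<le> C then a p * schur p ?L else 0)"
      unfolding prod[OF m] a by (simp add: sum.inter_filter[OF finite_parts])
    also have "\<dots> = (\<Sum>nu\<in>D. if row nu R \<le> C then a (row nu) * schur (row nu) ?L else 0)"
      by (rule sum.reindex_bij_betw[OF bij, symmetric])
    also have "\<dots> = (\<Sum>nu\<in>D. c0 nu * int (kostka nu alpha))"
      by (rule sum.cong) (auto simp: c0_def kostka[OF _ m])
    finally show "int (prod_coeff mus alpha) = (\<Sum>nu\<in>D. c0 nu * int (kostka nu alpha))" .
  qed (auto simp: c0_def D_def split: if_splits)
  have "c = c0" if c: "is_coeff c" for c
  proof
    fix nu
    show "c nu = c0 nu"
    proof (cases "nu \<in> D")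
      case False
      then have "c nu = 0" "c0 nu = 0" using c c0 unfolding is_coeff_def D_def by blast+
      then show ?thesis by simp
    next
      case True
      define g where "g = inv_into D row"
      have g: "g (row nu) = nu" if "nu \<in> D" for nu
        unfolding g_def using bij that by (simp add: bij_betw_def inv_into_f_f)
      have "(\<Sum>p\<in>parts d. (c (g p) - c0 (g p)) * schur p xs) = 0" for xs
      proof -
        \<comment> \<open>Every exponent list \<open>xs\<close> arises from a finitely supported
          \<open>alpha\<close>, by reversal and padding with zeros; hence the identities for all
          such \<open>alpha\<close> give the vanishing at every list that linear independence
          requires.\<close>
        define alpha where "alpha v = (if v < length xs then rev xs ! v else 0)" for v
        have m: "\<forall>v\<ge>length xs. alpha v = 0" by (simp add: alpha_def)
        have "map alpha [0..<length xs] = rev xs"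
          by (rule nth_equalityI) (auto simp: alpha_def)
        then have L: "rev (map alpha [0..<length xs]) = xs" by simp
        have "finite {v. alpha v \<noteq> 0}"
          by (rule finite_subset[of _ "{..<length xs}"]) (auto simp: alpha_def split: if_splits)
        then have "(\<Sum>nu\<in>D. c nu * int (kostka nu alpha)) = (\<Sum>nu\<in>D. c0 nu * int (kostka nu alpha))"
          using c c0 unfolding is_coeff_def by metis
        then have "0 = (\<Sum>nu\<in>D. (c nu - c0 nu) * int (kostka nu alpha))"
          by (simp add: left_diff_distrib sum_subtractf)
        also have "\<dots> = (\<Sum>nu\<in>D. (c (g (row nu)) - c0 (g (row nu))) * schur (row nu) xs)"
          by (rule sum.cong) (auto simp: g kostka[OF _ m] L)
        also have "\<dots> = (\<Sum>p\<in>parts d. (c (g p) - c0 (g p)) * schur p xs)"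
          by (rule sum.reindex_bij_betw[OF bij])
        finally show ?thesis by simp
      qed
      from schur_linear_independent[OF this, of "row nu"]
      show ?thesis using True g bij by (auto simp: bij_betw_def)
    qed
  qed
  with c0 have "(THE c. is_coeff c) = c0" by (rule the_equality)
  then have "LR_coeff la mus = c0 la"
    unfolding LR_coeff_def Let_def is_coeff_def D_def d_def by simp
  then show ?thesis using assms(4) by (auto simp: c0_def C_def R_def split: if_splits)
qed

theorem mainTheorem2:
  fixes la :: "nat list" and mus :: "nat list list"
  assumes "length mus \<ge> 1"
    and "is_partition la"
    and "\<forall>k < length mus. is_partition (mus ! k)"
    and "LR_coeff la mus \<noteq> 0"
  shows "diagram la \<subseteq> UNIV - up_closure (OC_sum mus)"
proof -
  have False if x: "x \<in> diagram la" "x \<in> up_closure (OC_sum mus)" for x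
  proof -
    obtain ps where ps: "length ps = length mus" "\<forall>k < length mus. ps ! k \<in> OC (mus ! k)"
      and le: "sum_list (map fst ps) \<le> fst x" "sum_list (map snd ps) \<le> snd x"
      using x(2) by (auto simp: up_closure_def OC_sum_def)
    \<comment> \<open>Row \<open>snd x\<close> is no longer than the row of the corner sum, so the
      bound there carries over and puts \<open>x\<close> outside the diagram.\<close>
    have "row la (snd x) \<le> row la (sum_list (map snd ps))"
      by (rule part_antimonoD[OF part_row[OF assms(2)] le(2)])
    also have "\<dots> \<le> sum_list (map fst ps)"
      by (rule LR_coeff_nonzero_row_le[OF ps(1) assms(3) ps(2) assms(4)])
    also note le(1)
    finally show False using x(1) by (auto simp: diagram_eq_cells cells_def)
  qed
  then show ?thesis by blast
qed

end
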